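(* Let $\mathcal{U}^{F,n}_{D,Q,\mathcal{P}}=(\mathcal{U}^{A}_{D,Q,\mathcal{P}},\mathcal{U}^{R}_{D,Q,\mathcal{P}})$ be a kernel-type Chudnovsky$^2$ multiplication algorithm in a finite field $\mathbb{F}_{q^n}$. Then $$\mu_{s,0}(\mathcal{U}^{A}_{D,Q,\mathcal{P}})\ge 2n^2\qquad\text{and}\qquad \mu_{s,0}(\mathcal{U}^{F,n}_{D,Q,\mathcal{P}})>2n^2.$$
   Context: Setting. $q$ is a prime power, $n\ge 1$ an integer, $F/\mathbb{F}_q$ an algebraic function field of genus $g$, $Q$ a place of $F/\mathbb{F}_q$ of degree $n$ with valuation ring $\mathcal{O}_Q$ and residue class field $F_Q=\mathcal{O}_Q/Q\cong\mathbb{F}_{q^n}$, $D$ a divisor of $F/\mathbb{F}_q$, and $\mathcal{P}=\{P_1,\dots,P_N\}$ an ordered set of distinct places of degree one. $\mathcal{L}(D)$ denotes the Riemann–Roch space of $D$. It is assumed that the support of $D$ contains none of $Q,P_1,\dots,P_N$, that $Ev_Q:\mathcal{L}(D)\to F_Q$, $f\mapsto f(Q)$, is surjective, and that $Ev_{\mathcal{P}}:\mathcal{L}(2D)\to\mathbb{F}_q^N$, $f\mapsto(f(P_1),\dots,f(P_N))$, is injective. In addition, $D$ is effective, $D-Q$ is a non-special divisor of degree $g-1$, and $N=|\mathcal{P}|=\dim\mathcal{L}(2D)$. Consequently $Ev_Q$ and $Ev_{\mathcal{P}}$ are isomorphisms, $\mathcal{L}(D)\subseteq\mathcal{L}(2D)\subseteq\mathcal{O}_Q$,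 $\deg D=n+g-1$, $\dim\mathcal{L}(D)=n$ and $N=2n+g-1$. Let $E_Q:\mathcal{O}_Q\to F_Q$ be the canonical projection. The Chudnovsky$^2$ multiplication algorithm $\mathcal{U}^{F,n}_{D,Q,\mathcal{P}}$ computes $xy=\mathcal{U}^R(\mathcal{U}^A(x)\odot\mathcal{U}^A(y))$ for $x,y\in F_Q$, with $\odot$ the coordinatewise product, $\mathcal{U}^{A}:=Ev_{\mathcal{P}}|_{\mathcal{L}(D)}\circ Ev_Q^{-1}$ and $\mathcal{U}^{R}:=E_Q|_{\mathcal{L}(2D)}\circ Ev_{\mathcal{P}}^{-1}$. Kernel-type: the algorithm is kernel-type if the (ordered) basis of $\mathcal{L}(2D)$ used is $\mathcal{B}_{2D}=\mathcal{B}_D\cup\mathcal{B}_D^c$, with first $n$ elements $\mathcal{B}_D$ a basis of $\mathcal{L}(D)$ and last $N-n$ elements $\mathcal{B}_D^c$ a basis of $\ker(E_Q|_{\mathcal{L}(2D)})$, which is a complement of $\mathcal{L}(D)$ in $\mathcal{L}(2D)$. The basis of $F_Q$ is $\mathcal{B}_Q=Ev_Q(\mathcal{B}_D)$. Matrices. $\mathbb{F}_q^N$ has its canonical basis. $T_{2D}$ is the matrix of $Ev_{\mathcal{P}}$ in the basis $\mathcal{B}_{2D}$; $T_D$ is the matrix of the first $n$ columns of $T_{2D}$, i.e. the matrix of $Ev_{\mathcal{P}}|_{\mathcal{L}(D)}$ in the basis $\mathcal{B}_D$; $C$ is the matrix of $E_Q|_{\mathcal{L}(2D)}$ in the bases $\mathcal{B}_{2D}$,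 $\mathcal{B}_Q$. $N_z(M)$ is the number of zero entries of a matrix $M$. Scalar complexities (counting only savings due to zero entries): $\mu_{s,0}(\mathcal{U}^A_{D,Q,\mathcal{P}})=2\bigl(n(2n+g-1)-N_z(T_D)\bigr)$ and $\mu_{s,0}(\mathcal{U}^{F,n}_{D,Q,\mathcal{P}})=3n(2n+g-1)-2N_z(T_D)-N_z(C\,T_{2D}^{-1})$. *)

theory Defs
  imports
    "Jordan_Normal_Form.Gauss_Jordan_Elimination"
    "HOL-Computational_Algebra.Polynomial"
    "HOL-Library.Poly_Mapping"
begin

section \<open>Algebraic function fields of one variable\<close>

text \<open>
  A function field \<open>F/K\<close> is given by a field type \<open>'f\<close> for \<open>F\<close>, a field type \<open>'k\<close> for \<open>K\<close>, and the
  embedding \<open>\<iota> : K \<rightarrow> F\<close>, through which \<open>K\<close> is regarded as a subfield of \<open>F\<close>.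
\<close>

definition transcendental_over :: "('k::field \<Rightarrow> 'f::field) \<Rightarrow> 'f \<Rightarrow> bool" where
  "transcendental_over \<iota> x \<longleftrightarrow> (\<forall>p. p \<noteq> 0 \<longrightarrow> poly (map_poly \<iota> p) x \<noteq> 0)"

definition simple_extension :: "('k::field \<Rightarrow> 'f::field) \<Rightarrow> 'f \<Rightarrow> 'f set" where
  "simple_extension \<iota> x =
     {poly (map_poly \<iota> p) x / poly (map_poly \<iota> r) x | p r. poly (map_poly \<iota> r) x \<noteq> 0}"

locale function_field = field_hom \<iota> for \<iota> :: "'k::field \<Rightarrow> 'f::field" +
  assumes finite_over_rational_subfield:
    "\<exists>x. transcendental_over \<iota> x \<and>
       (\<exists>B. finite B \<and>
         (\<forall>y. \<exists>c. (\<forall>b\<in>B. c b \<in> simple_extension \<iota> x) \<and> y = (\<Sum>b\<in>B. c b * b)))"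

sublocale function_field \<subseteq> K: vector_space "\<lambda>c f. \<iota> c * f"
  by unfold_locales (simp_all add: algebra_simps hom_distribs)

subsection \<open>Places and valuations\<close>

definition is_valuation_ring :: "('k::field \<Rightarrow> 'f::field) \<Rightarrow> 'f set \<Rightarrow> bool" where
  "is_valuation_ring \<iota> R \<longleftrightarrow>
     (\<forall>x\<in>R. \<forall>y\<in>R. x + y \<in> R \<and> x * y \<in> R \<and> - x \<in> R) \<and>
     range \<iota> \<subset> R \<and> R \<subset> UNIV \<and> (\<forall>z. z \<in> R \<or> inverse z \<in> R)"

definition nonunits :: "'f::field set \<Rightarrow> 'f set" where
  "nonunits R = {x \<in> R. x = 0 \<or> inverse x \<notin> R}"

text \<open>A place is the maximal ideal, i.e. the set of non-units, of a valuation ring.\<close>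

definition is_place :: "('k::field \<Rightarrow> 'f::field) \<Rightarrow> 'f set \<Rightarrow> bool" where
  "is_place \<iota> P \<longleftrightarrow> (\<exists>R. is_valuation_ring \<iota> R \<and> P = nonunits R)"

text \<open>
  A place \<open>P\<close> determines its valuation ring \<open>O\<^sub>P\<close>. The case \<open>z = 0\<close> is separate because
  \<open>inverse 0 = 0\<close> lies in \<open>P\<close>.
\<close>

definition place_ring :: "'f::field set \<Rightarrow> 'f set" where
  "place_ring P = {z. z = 0 \<or> inverse z \<notin> P}"

lemma place_ring_nonunits:
  assumes "is_valuation_ring \<iota> R"
  shows "place_ring (nonunits R) = R"
proof -
  have "\<iota> 0 \<in> R" "- \<iota> 0 \<in> R"
    using assms unfolding is_valuation_ring_def by blast+
  hence "\<iota> 0 + - \<iota> 0 \<in> R"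
    using assms unfolding is_valuation_ring_def by blast
  thus ?thesis
    using assms by (auto simp: place_ring_def nonunits_def is_valuation_ring_def)
qed

definition prime_element :: "'f::field set \<Rightarrow> 'f \<Rightarrow> bool" where
  "prime_element P t \<longleftrightarrow> P = {t * y | y. y \<in> place_ring P}"

text \<open>
  The normalized discrete valuation: \<open>valuation P z = m\<close> iff \<open>z = t\<^sup>m u\<close> for a prime element \<open>t\<close> and
  a unit \<open>u\<close> of \<open>O\<^sub>P\<close>. It is meaningful for \<open>z \<noteq> 0\<close> only; the value \<open>\<infinity>\<close> at \<open>0\<close> is treated separately
  where it matters.
\<close>

definition valuation :: "'f::field set \<Rightarrow> 'f \<Rightarrow> int" where
  "valuation P z =
     (THE m. \<exists>t u. prime_element P t \<and> u \<in> place_ring P - P \<and> z = t powi m * u)"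

subsection \<open>Residue class fields and degrees of places\<close>

text \<open>
  \<open>residue_class P z\<close> is the coset \<open>z + P\<close>, written \<open>z(P)\<close> in the literature.
\<close>

definition residue_class :: "'f::field set \<Rightarrow> 'f \<Rightarrow> 'f set" where
  "residue_class P z = {w. w - z \<in> P}"

definition residue_field :: "'f::field set \<Rightarrow> 'f set set" where
  "residue_field P = residue_class P ` place_ring P"

definition lin_comb :: "('k::field \<Rightarrow> 'f::field) \<Rightarrow> 'k vec \<Rightarrow> 'f list \<Rightarrow> 'f" where
  "lin_comb \<iota> c bs = (\<Sum>j<length bs. \<iota> (c $ j) * bs ! j)"

text \<open>
  The \<open>K\<close>-vector space structure of \<open>O\<^sub>P/P\<close> is the one induced from \<open>O\<^sub>P\<close>. Hence \<open>c\<close> is the coordinate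
  vector of a residue class with respect to the classes of \<open>bs\<close> iff that class is the class
  of \<open>lin_comb \<iota> c bs\<close>.
\<close>

definition is_residue_coords ::
    "('k::field \<Rightarrow> 'f::field) \<Rightarrow> 'f set \<Rightarrow> 'f list \<Rightarrow> 'f set \<Rightarrow> 'k vec \<Rightarrow> bool" where
  "is_residue_coords \<iota> P bs x c \<longleftrightarrow>
     c \<in> carrier_vec (length bs) \<and> x = residue_class P (lin_comb \<iota> c bs)"

definition residue_coords ::
    "('k::field \<Rightarrow> 'f::field) \<Rightarrow> 'f set \<Rightarrow> 'f list \<Rightarrow> 'f set \<Rightarrow> 'k vec" where
  "residue_coords \<iota> P bs x = (THE c. is_residue_coords \<iota> P bs x c)"

definition residue_basis :: "('k::field \<Rightarrow> 'f::field) \<Rightarrow> 'f set \<Rightarrow> 'f list \<Rightarrow> bool" where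
  "residue_basis \<iota> P bs \<longleftrightarrow>
     set bs \<subseteq> place_ring P \<and> (\<forall>x\<in>residue_field P. \<exists>!c. is_residue_coords \<iota> P bs x c)"

definition place_degree :: "('k::field \<Rightarrow> 'f::field) \<Rightarrow> 'f set \<Rightarrow> nat" where
  "place_degree \<iota> P = (THE d. \<exists>bs. residue_basis \<iota> P bs \<and> length bs = d)"

text \<open>
  At a place of degree one, \<open>O\<^sub>P/P\<close> is identified with \<open>K\<close>, so that \<open>f(P)\<close> becomes an element of \<open>K\<close>.
\<close>

definition eval_at :: "('k::field \<Rightarrow> 'f::field) \<Rightarrow> 'f set \<Rightarrow> 'f \<Rightarrow> 'k" where
  "eval_at \<iota> P f = (THE c. residue_class P f = residue_class P (\<iota> c))"

subsection \<open>Divisors, Riemann--Roch spaces and the genus\<close>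

type_synonym 'f divisor = "'f set \<Rightarrow>\<^sub>0 int"

abbreviation place_divisor :: "'f set \<Rightarrow> 'f divisor" where
  "place_divisor P \<equiv> Poly_Mapping.single P 1"

definition effective :: "'f divisor \<Rightarrow> bool" where
  "effective A \<longleftrightarrow> (\<forall>P. 0 \<le> Poly_Mapping.lookup A P)"

context function_field
begin

definition is_divisor :: "'f divisor \<Rightarrow> bool" where
  "is_divisor A \<longleftrightarrow> (\<forall>P\<in>Poly_Mapping.keys A. is_place \<iota> P)"

definition divisor_degree :: "'f divisor \<Rightarrow> int" where
  "divisor_degree A = (\<Sum>P\<in>Poly_Mapping.keys A. Poly_Mapping.lookup A P * int (place_degree \<iota> P))"

definition RR_space :: "'f divisor \<Rightarrow> 'f set" where
  "RR_space A = {f. f = 0 \<or> (\<forall>P. is_place \<iota> P \<longrightarrow> - Poly_Mapping.lookup A P \<le> valuation P f)}"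

definition RR_dim :: "'f divisor \<Rightarrow> nat" where
  "RR_dim A = K.dim (RR_space A)"

definition genus :: int where
  "genus = (GREATEST i. \<exists>A. is_divisor A \<and> i = divisor_degree A - int (RR_dim A) + 1)"

text \<open>The index of speciality of a divisor; non-special means that it vanishes.\<close>

definition speciality_index :: "'f divisor \<Rightarrow> int" where
  "speciality_index A = int (RR_dim A) - divisor_degree A + genus - 1"

definition nonspecial :: "'f divisor \<Rightarrow> bool" where
  "nonspecial A \<longleftrightarrow> speciality_index A = 0"

definition ordered_basis :: "'f list \<Rightarrow> 'f set \<Rightarrow> bool" where
  "ordered_basis bs V \<longleftrightarrow> distinct bs \<and> K.independent (set bs) \<and> K.span (set bs) = V"

end

section \<open>Chudnovsky--Chudnovsky multiplication algorithms\<close>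

definition num_zeros :: "'a::zero mat \<Rightarrow> nat" where
  "num_zeros M = card {(i, j). i < dim_row M \<and> j < dim_col M \<and> M $$ (i, j) = 0}"

definition (in function_field) Ev_P :: "'f set list \<Rightarrow> 'f \<Rightarrow> 'k vec" where
  "Ev_P Ps f = vec (length Ps) (\<lambda>i. eval_at \<iota> (Ps ! i) f)"

text \<open>
  \<open>Ev\<^sub>Q\<close> and the canonical projection \<open>E\<^sub>Q\<close> are both restrictions of \<open>residue_class Q\<close>, to \<open>\<L>(D)\<close> and to
  \<open>O\<^sub>Q\<close> respectively.
\<close>

locale chudnovsky = function_field \<iota>
  for \<iota> :: "'k::{field,finite} \<Rightarrow> 'f::field" +
  fixes n :: nat and D :: "'f divisor" and Q :: "'f set" and Ps :: "'f set list"
  assumes n_pos: "1 \<le> n"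
    and place_Q: "is_place \<iota> Q" and degree_Q: "place_degree \<iota> Q = n"
    and distinct_Ps: "distinct Ps"
    and places_Ps: "\<And>P. P \<in> set Ps \<Longrightarrow> is_place \<iota> P \<and> place_degree \<iota> P = 1"
    and divisor_D: "is_divisor D"
    and support_D: "Poly_Mapping.keys D \<inter> insert Q (set Ps) = {}"
    and Ev_Q_surj: "residue_class Q ` RR_space D = residue_field Q"
    and Ev_P_inj: "inj_on (Ev_P Ps) (RR_space (D + D))"
    and effective_D: "effective D"
    and D_minus_Q_nonspecial: "nonspecial (D - place_divisor Q)"
    and D_minus_Q_degree: "divisor_degree (D - place_divisor Q) = genus - 1"
    and length_Ps: "length Ps = RR_dim (D + D)"
begin

definition U_A :: "'f set \<Rightarrow> 'k vec" where
  "U_A x = Ev_P Ps (inv_into (RR_space D) (residue_class Q) x)"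

definition U_R :: "'k vec \<Rightarrow> 'f set" where
  "U_R v = residue_class Q (inv_into (RR_space (D + D)) (Ev_P Ps) v)"

definition U :: "'f set \<Rightarrow> 'f set \<Rightarrow> 'f set" where
  "U x y = U_R (vec (length Ps) (\<lambda>i. U_A x $ i * U_A y $ i))"

end

text \<open>
  The basis of \<open>\<L>(2D)\<close> is \<open>BD @ BDc\<close>, and the basis of the residue class field of \<open>Q\<close> consists
  of the classes of the elements of \<open>BD\<close>.
\<close>

locale kernel_type_chudnovsky = chudnovsky \<iota> n D Q Ps
  for \<iota> :: "'k::{field,finite} \<Rightarrow> 'f::field"
    and n :: nat and D :: "'f divisor" and Q :: "'f set" and Ps :: "'f set list" +
  fixes BD BDc :: "'f list"
  assumes basis_2D: "ordered_basis (BD @ BDc) (RR_space (D + D))"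
    and basis_D: "ordered_basis BD (RR_space D)"
    and length_BD: "length BD = n"
    and basis_kernel:
      "ordered_basis BDc {f \<in> RR_space (D + D). residue_class Q f = residue_class Q 0}"
    and length_BDc: "length BDc = length Ps - n"

context function_field
begin

definition Ev_P_matrix :: "'f set list \<Rightarrow> 'f list \<Rightarrow> 'k mat" where
  "Ev_P_matrix Ps bs = mat (length Ps) (length bs) (\<lambda>(i, j). Ev_P Ps (bs ! j) $ i)"

definition T_2D :: "'f set list \<Rightarrow> 'f list \<Rightarrow> 'f list \<Rightarrow> 'k mat" where
  "T_2D Ps BD BDc = Ev_P_matrix Ps (BD @ BDc)"

definition T_D :: "'f set list \<Rightarrow> 'f list \<Rightarrow> 'k mat" where
  "T_D Ps BD = Ev_P_matrix Ps BD"

definition C_matrix :: "'f set \<Rightarrow> 'f list \<Rightarrow> 'f list \<Rightarrow> 'k mat" where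
  "C_matrix Q BD BDc = mat (length BD) (length (BD @ BDc))
     (\<lambda>(i, j). residue_coords \<iota> Q BD (residue_class Q ((BD @ BDc) ! j)) $ i)"

text \<open>
  Scalar complexities counting only the savings due to zero entries, of the pair of evaluations
  \<open>U\<^sup>A\<close> and of the whole algorithm.
\<close>

definition mu_s0_A :: "nat \<Rightarrow> 'f set list \<Rightarrow> 'f list \<Rightarrow> int" where
  "mu_s0_A n Ps BD = 2 * (int n * (2 * int n + genus - 1) - int (num_zeros (T_D Ps BD)))"

definition mu_s0 :: "nat \<Rightarrow> 'f set \<Rightarrow> 'f set list \<Rightarrow> 'f list \<Rightarrow> 'f list \<Rightarrow> int" where
  "mu_s0 n Q Ps BD BDc =
     3 * int n * (2 * int n + genus - 1) - 2 * int (num_zeros (T_D Ps BD))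
       - int (num_zeros (C_matrix Q BD BDc * the (mat_inverse (T_2D Ps BD BDc))))"

end

end

theory Submission
  imports Defs "Jordan_Normal_Form.Determinant"
begin

text \<open>
  Write \<open>N\<close> for the number of evaluation points, \<open>T\<close> for the matrix \<open>T_2D\<close> and \<open>g\<close> for the genus. The
  complexities count nonzero entries against matrices of \<open>2n + g - 1\<close> rows or columns, so the theorem
  amounts to bounds for the numbers of zeros in \<open>T_D\<close> and \<open>C T\<^sup>-\<^sup>1\<close>, together with \<open>N \<le> 2n + g - 1\<close>.

  A column of \<open>T_D\<close> lists the values of a nonzero \<open>f \<in> \<L>(D)\<close> at the points. The space \<open>f \<L>(D)\<close> has
  dimension \<open>n\<close>, lies in \<open>\<L>(2D)\<close>, and vanishes wherever \<open>f\<close> does. As \<open>\<L>(2D)\<close> embeds into \<open>K\<^sup>N\<close> by evaluation,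
  at least \<open>n\<close> points are not zeros of \<open>f\<close> (\<open>card_zeros_le\<close>). So \<open>T_D\<close> has at most \<open>n (N - n)\<close> zeros, which is
  at most \<open>n (n + g - 1)\<close> by \<open>N \<le> 2n + g - 1\<close>, and the first inequality follows. The second one is strict
  because in addition \<open>C T\<^sup>-\<^sup>1\<close> is not the zero matrix: \<open>C\<close> contains an identity block
  (\<open>num_zeros_reconstruction_less\<close>).

  The inequality \<open>N \<le> 2n + g - 1\<close> (\<open>length_Ps_le\<close>) rests on the fact that adding a place \<open>P\<close> to a divisor
  increases the dimension of its Riemann--Roch space by at most \<open>deg P\<close>: starting from \<open>dim \<L>(D) = n\<close>, the
  effective divisor \<open>D\<close> of degree \<open>n + g - 1\<close> is added once more. This in turn needs the local theory of
  places, namely that \<open>P\<close> is generated by one element, that every nonzero function is an integral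
  power of a generator times a unit, and that the residue class field is finite-dimensional over \<open>K\<close>. All three
  follow from one finiteness statement, \<open>polynomially_independent_bounded\<close>: for each \<open>x \<in> F\<close> there is a
  bound for the number of elements of \<open>F\<close> that are linearly independent over \<open>K[x]\<close>. Applied to some
  \<open>x \<in> P\<close>, it bounds the length of chains of strict divisibility and the number of independent residue
  classes.
\<close>

section \<open>Linear algebra modulo a subspace\<close>

text \<open>
  Padding the coefficient matrix with zero rows to a square matrix makes it singular, since its
  transpose annihilates the last unit vector.
\<close>

lemma underdetermined_system_nontrivial:
  fixes a :: "nat \<Rightarrow> nat \<Rightarrow> 'a::field"
  assumes "m < n"
  obtains v where "v \<in> carrier_vec n" "v \<noteq> 0\<^sub>v n" "\<And>i. i < m \<Longrightarrow> (\<Sum>j<n. a i j * v $ j) = 0"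
proof -
  define A where "A = mat n n (\<lambda>(i, j). if i < m then a i j else 0)"
  have A: "A \<in> carrier_mat n n"
    by (simp add: A_def)
  have "transpose_mat A *\<^sub>v unit_vec n (n - 1) = 0\<^sub>v n"
    using assms by (intro eq_vecI) (auto simp: A_def scalar_prod_def unit_vec_def intro!: sum.neutral)
  moreover have "unit_vec n (n - 1) \<noteq> (0\<^sub>v n :: 'a vec)"
    using assms by (auto dest!: arg_cong[of _ _ "\<lambda>v. v $ (n - 1)"])
  ultimately have "det (transpose_mat A) = 0"
    using A by (subst det_0_iff_vec_prod_zero_field[of _ n])
      (auto intro!: exI[of _ "unit_vec n (n - 1)"])
  then have "det A = 0"
    using det_transpose[OF A] by simp
  then obtain v where v: "v \<in> carrier_vec n" "v \<noteq> 0\<^sub>v n" "A *\<^sub>v v = 0\<^sub>v n"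
    using det_0_iff_vec_prod_zero_field[OF A] by blast
  show thesis
  proof (rule that[OF v(1,2)])
    fix i assume i: "i < m"
    have "(A *\<^sub>v v) $ i = (\<Sum>j<n. a i j * v $ j)"
      using i assms v(1) by (auto simp: A_def scalar_prod_def lessThan_atLeast0 intro!: sum.cong)
    then show "(\<Sum>j<n. a i j * v $ j) = 0"
      using v(3) i assms by simp
  qed
qed

lemma underdetermined_finite_system_nontrivial:
  fixes a :: "'i \<Rightarrow> nat \<Rightarrow> 'a::field"
  assumes "finite I" "card I < n"
  obtains v where "v \<in> carrier_vec n" "v \<noteq> 0\<^sub>v n" "\<And>i. i \<in> I \<Longrightarrow> (\<Sum>j<n. v $ j * a i j) = 0"
proof -
  obtain h where h: "bij_betw h {..<card I} I"
    using ex_bij_betw_nat_finite[OF assms(1)] by (auto simp: lessThan_atLeast0)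
  obtain v where "v \<in> carrier_vec n" "v \<noteq> 0\<^sub>v n"
    and v: "\<And>i. i < card I \<Longrightarrow> (\<Sum>j<n. a (h i) j * v $ j) = 0"
    by (rule underdetermined_system_nontrivial[OF assms(2), of "\<lambda>i. a (h i)"]) blast
  moreover have "(\<Sum>j<n. a i j * v $ j) = 0" if "i \<in> I" for i
  proof -
    from h that obtain k where "k < card I" "i = h k"
      by (auto simp: bij_betw_def)
    then show ?thesis
      using v by blast
  qed
  ultimately show thesis
    using that by (simp add: mult.commute)
qed

text \<open>
  The Steinitz bound for indexed families. Repetitions are allowed: a vector that occurs twice gives
  a relation with the coefficients \<open>1\<close> and \<open>-1\<close>.
\<close>

lemma (in vector_space) exists_nontrivial_relation:
  fixes v :: "'i \<Rightarrow> 'b"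
  assumes "finite I" "finite T" "card T < card I" "v ` I \<subseteq> span T"
  obtains c where "\<exists>i\<in>I. c i \<noteq> 0" "(\<Sum>i\<in>I. c i *s v i) = 0"
proof (cases "inj_on v I")
  case True
  have "dependent (v ` I)"
    using independent_span_bound[of T "v ` I"] assms card_image[OF True] by force
  then obtain u where u: "\<exists>w\<in>v ` I. u w \<noteq> 0" "(\<Sum>w\<in>v ` I. u w *s w) = 0"
    using assms(1) by (auto simp: dependent_finite)
  then show thesis
    using that[of "u \<circ> v"] by (auto simp: sum.reindex[OF True])
next
  case False
  then obtain i k where ik: "i \<in> I" "k \<in> I" "i \<noteq> k" "v i = v k"
    by (auto simp: inj_on_def)
  define c :: "'i \<Rightarrow> 'a" where "c = (\<lambda>l. if l = i then 1 else if l = k then - 1 else 0)"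
  have "(\<Sum>l\<in>I. c l *s v l) = (\<Sum>l\<in>{i, k}. c l *s v l)"
    using assms(1) ik by (intro sum.mono_neutral_right) (auto simp: c_def)
  also have "\<dots> = 0"
    using ik by (simp add: c_def)
  finally show thesis
    using that[of c] ik by (metis c_def one_neq_zero)
qed

context function_field
begin

lemma subspace_iff:
  "K.subspace U \<longleftrightarrow> 0 \<in> U \<and> (\<forall>x\<in>U. \<forall>y\<in>U. x + y \<in> U) \<and> (\<forall>c. \<forall>x\<in>U. \<iota> c * x \<in> U)"
  by (auto simp: K.subspace_def)

lemma lin_comb_Nil [simp]: "lin_comb \<iota> c [] = 0"
  by (simp add: lin_comb_def)

lemma lin_comb_vCons [simp]: "lin_comb \<iota> (vCons a c) (b # bs) = \<iota> a * b + lin_comb \<iota> c bs"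
  by (simp add: lin_comb_def sum.lessThan_Suc_shift del: sum.lessThan_Suc)

lemma lin_comb_zero [simp]: "lin_comb \<iota> (0\<^sub>v (length bs)) bs = 0"
  by (simp add: lin_comb_def)

lemma lin_comb_diff:
  assumes "c \<in> carrier_vec (length bs)" "d \<in> carrier_vec (length bs)"
  shows "lin_comb \<iota> (c - d) bs = lin_comb \<iota> c bs - lin_comb \<iota> d bs"
  using assms by (simp add: lin_comb_def hom_distribs sum_subtractf algebra_simps)

lemma lin_comb_smult:
  assumes "c \<in> carrier_vec (length bs)"
  shows "lin_comb \<iota> (a \<cdot>\<^sub>v c) bs = \<iota> a * lin_comb \<iota> c bs"
  using assms by (simp add: lin_comb_def hom_distribs sum_distrib_left algebra_simps)

lemma lin_comb_in_subspace:
  assumes "K.subspace U" "set bs \<subseteq> U"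
  shows "lin_comb \<iota> c bs \<in> U"
  unfolding lin_comb_def using assms
  by (intro K.subspace_sum) (auto simp: subspace_iff dest!: nth_mem)

lemma lin_comb_map_mult: "lin_comb \<iota> c (map ((*) a) bs) = a * lin_comb \<iota> c bs"
  by (simp add: lin_comb_def sum_distrib_left algebra_simps)

lemma lin_comb_append:
  assumes "c \<in> carrier_vec (length bs)"
  shows "lin_comb \<iota> (c @\<^sub>v d) (bs @ cs) = lin_comb \<iota> c bs + lin_comb \<iota> d cs"
  using assms
proof (induction bs arbitrary: c)
  case Nil
  then have "c = vNil" by auto
  then show ?case by simp
next
  case (Cons b bs)
  then obtain a c' where "c = vCons a c'" "c' \<in> carrier_vec (length bs)"
    by (cases c) auto
  then show ?case
    using Cons.IH by (simp add: add.assoc)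
qed

lemma in_span_list_iff:
  "w \<in> K.span (set bs) \<longleftrightarrow> (\<exists>c\<in>carrier_vec (length bs). w = lin_comb \<iota> c bs)"
proof
  assume "w \<in> K.span (set bs)"
  then show "\<exists>c\<in>carrier_vec (length bs). w = lin_comb \<iota> c bs"
  proof (induction bs arbitrary: w)
    case Nil
    then show ?case by (intro bexI[of _ "0\<^sub>v 0"]) auto
  next
    case (Cons b bs)
    then obtain a where "w - \<iota> a * b \<in> K.span (set bs)"
      by (auto simp: K.span_insert)
    then obtain c where "c \<in> carrier_vec (length bs)" "w - \<iota> a * b = lin_comb \<iota> c bs"
      using Cons.IH by blast
    then show ?case
      by (intro bexI[of _ "vCons a c"]) (auto simp: algebra_simps)
  qed
qed (auto intro!: lin_comb_in_subspace K.span_superset)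

text \<open>
  Independence in \<open>F/U\<close>, phrased in \<open>F\<close> itself. The choices \<open>U = 0\<close>, \<open>U = P\<close> and \<open>U = \<L>(A)\<close> give
  independence in \<open>F\<close>, in a residue class field, and in a quotient of Riemann--Roch spaces.
\<close>

definition independent_mod :: "'f set \<Rightarrow> 'f list \<Rightarrow> bool" where
  "independent_mod U bs \<longleftrightarrow>
     (\<forall>c\<in>carrier_vec (length bs). lin_comb \<iota> c bs \<in> U \<longrightarrow> c = 0\<^sub>v (length bs))"

lemma independent_modD:
  "independent_mod U bs \<Longrightarrow> c \<in> carrier_vec (length bs) \<Longrightarrow> lin_comb \<iota> c bs \<in> U
    \<Longrightarrow> c = 0\<^sub>v (length bs)"
  by (auto simp: independent_mod_def)

lemma independent_mod_Nil: "independent_mod U []"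
  by (auto simp: independent_mod_def)

text \<open>
  \<open>K.independent\<close> concerns sets and coefficients indexed by vectors; for a list
  without repetitions, positions can serve as the index instead.
\<close>

lemma independent_mod_zeroI:
  assumes "distinct bs" "K.independent (set bs)"
  shows "independent_mod {0} bs"
  unfolding independent_mod_def
proof (intro ballI impI eq_vecI)
  fix c i assume c: "c \<in> carrier_vec (length bs)" "lin_comb \<iota> c bs \<in> {0}" and i: "i < dim_vec (0\<^sub>v (length bs))"
  define pos where "pos = the_inv_into {..<length bs} ((!) bs)"
  have inj: "inj_on ((!) bs) {..<length bs}"
    using assms(1) by (auto intro: inj_on_nth)
  have img: "set bs = (!) bs ` {..<length bs}"
    by (auto simp: set_conv_nth)
  have pos: "pos (bs ! j) = j" if "j < length bs" for j
    using that inj by (simp add: pos_def the_inv_into_f_f)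
  have "(\<Sum>b\<in>set bs. \<iota> (c $ pos b) * b) = 0"
    using c unfolding img by (simp add: sum.reindex[OF inj] lin_comb_def pos)
  then have "c $ pos (bs ! i) = 0"
    using K.independentD[OF assms(2) finite_set order_refl, of "\<lambda>b. c $ pos b" "bs ! i"] i by simp
  then show "c $ i = 0\<^sub>v (length bs) $ i"
    using i pos by simp
qed (simp add: carrier_vecD)

text \<open>
  In a relation that involves \<open>w\<close> the coefficient of \<open>w\<close> can be inverted, which would place \<open>w\<close> in the
  span of \<open>bs\<close> modulo \<open>U\<close>.
\<close>

lemma independent_mod_Cons:
  assumes "K.subspace U" "independent_mod U bs"
    and w: "\<And>c. c \<in> carrier_vec (length bs) \<Longrightarrow> w - lin_comb \<iota> c bs \<notin> U"
  shows "independent_mod U (w # bs)"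
  unfolding independent_mod_def
proof (intro ballI impI)
  fix c assume c: "c \<in> carrier_vec (length (w # bs))" "lin_comb \<iota> c (w # bs) \<in> U"
  then obtain a d where ad: "c = vCons a d" "d \<in> carrier_vec (length bs)"
    by (cases c) auto
  have "a = 0"
  proof (rule ccontr)
    assume "a \<noteq> 0"
    have "\<iota> (inverse a) * lin_comb \<iota> c (w # bs) \<in> U"
      using c(2) assms(1) by (auto simp: subspace_iff)
    also have "\<iota> (inverse a) * lin_comb \<iota> c (w # bs) = w - lin_comb \<iota> ((- inverse a) \<cdot>\<^sub>v d) bs"
      using \<open>a \<noteq> 0\<close> ad by (simp add: lin_comb_smult hom_distribs field_simps)
    finally show False
      using w[of "(- inverse a) \<cdot>\<^sub>v d"] ad by simp
  qed
  then show "c = 0\<^sub>v (length (w # bs))"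
    using c ad assms(2) by (auto simp: zero_vec_Suc dest: independent_modD)
qed

text \<open>
  A list of maximal length among those that are independent modulo \<open>U\<close> spans \<open>W\<close> modulo \<open>U\<close>. This
  produces bases of residue class fields as well as of quotients of Riemann--Roch spaces.
\<close>

lemma exists_basis_mod:
  assumes U: "K.subspace U"
    and bound: "\<And>bs. set bs \<subseteq> W \<Longrightarrow> independent_mod U bs \<Longrightarrow> length bs \<le> m"
  obtains bs where "set bs \<subseteq> W" "independent_mod U bs"
    "\<And>w. w \<in> W \<Longrightarrow> \<exists>c\<in>carrier_vec (length bs). w - lin_comb \<iota> c bs \<in> U"
proof -
  let ?ok = "\<lambda>bs. set bs \<subseteq> W \<and> independent_mod U bs"
  have "?ok []" by (simp add: independent_mod_Nil)
  moreover have "\<forall>bs. ?ok bs \<longrightarrow> length bs < Suc m"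
    using bound by (auto simp: less_Suc_eq_le)
  ultimately obtain bs where bs: "?ok bs" and max: "\<And>cs. ?ok cs \<Longrightarrow> length cs \<le> length bs"
    using ex_has_greatest_nat[of ?ok "[]" length "Suc m"] by metis
  show thesis
  proof (rule that[of bs])
    fix w assume w: "w \<in> W"
    have "\<not> independent_mod U (w # bs)"
      using max[of "w # bs"] bs w by auto
    then show "\<exists>c\<in>carrier_vec (length bs). w - lin_comb \<iota> c bs \<in> U"
      using independent_mod_Cons[OF U] bs by blast
  qed (use bs in auto)
qed

text \<open>
  Replacing each vector of an independent list by a representative of its class in the span of \<open>T\<close>
  turns a relation between the representatives into a relation modulo \<open>U\<close>. So the Steinitz bound
  carries over to the quotient.
\<close>

lemma independent_mod_length_le:
  assumes U: "K.subspace U" and ind: "independent_mod U bs" and T: "finite T"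
    and rep: "\<And>b. b \<in> set bs \<Longrightarrow> \<exists>w\<in>K.span T. b - w \<in> U"
  shows "length bs \<le> card T"
proof (rule ccontr)
  assume "\<not> length bs \<le> card T"
  then have "card T < card {..<length bs}" by simp
  moreover have "\<exists>w. \<forall>i\<in>{..<length bs}. w i \<in> K.span T \<and> bs ! i - w i \<in> U"
    by (rule bchoice) (use rep nth_mem in blast)
  then obtain w where w: "\<And>i. i < length bs \<Longrightarrow> w i \<in> K.span T \<and> bs ! i - w i \<in> U"
    by blast
  have "w ` {..<length bs} \<subseteq> K.span T"
    using w by blast
  ultimately obtain c where c: "\<exists>i\<in>{..<length bs}. c i \<noteq> 0" "(\<Sum>i<length bs. \<iota> (c i) * w i) = 0"
    using K.exists_nontrivial_relation[of "{..<length bs}" T w] T by blast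
  have "(\<Sum>i<length bs. \<iota> (c i) * (bs ! i - w i)) \<in> U"
    by (rule K.subspace_sum[OF U]) (use w K.subspace_scale[OF U] in simp)
  also have "(\<Sum>i<length bs. \<iota> (c i) * (bs ! i - w i)) = lin_comb \<iota> (vec (length bs) c) bs"
    using c(2) by (simp add: lin_comb_def algebra_simps sum_subtractf)
  finally have "vec (length bs) c = 0\<^sub>v (length bs)"
    by (intro independent_modD[OF ind]) simp_all
  then show False
    using c(1) by (auto simp: vec_eq_iff)
qed

end

section \<open>Polynomial relations in a function field\<close>

context function_field
begin

text \<open>
  The elements \<open>\<Sum>b\<in>B. p\<^sub>b(z) b\<close> with polynomials \<open>p\<^sub>b\<close> of degree at most \<open>k\<close>. When \<open>B\<close> spans \<open>F\<close> over \<open>K(z)\<close>,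
  these spaces exhaust \<open>F\<close> up to denominators, while their dimensions are at most \<open>(k + 1) card B\<close>.
\<close>

definition graded_span :: "'f \<Rightarrow> 'f set \<Rightarrow> nat \<Rightarrow> 'f set" where
  "graded_span z B k = K.span ((\<lambda>(i, b). z ^ i * b) ` ({..k} \<times> B))"

text \<open>
  An analogue of having degree at most \<open>e\<close> in \<open>z\<close> that makes sense for elements outside \<open>K[z]\<close>. It holds for
  polynomials of degree \<open>e\<close> in \<open>z\<close>, and the bounds add up under multiplication.
\<close>

definition raises :: "'f \<Rightarrow> 'f set \<Rightarrow> nat \<Rightarrow> 'f \<Rightarrow> bool" where
  "raises z B e h \<longleftrightarrow> (\<forall>k. \<forall>v\<in>graded_span z B k. h * v \<in> graded_span z B (k + e))"

lemma subspace_graded_span: "K.subspace (graded_span z B k)"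
  by (simp add: graded_span_def)

lemma graded_span_mono: "k \<le> l \<Longrightarrow> graded_span z B k \<subseteq> graded_span z B l"
  unfolding graded_span_def by (intro K.span_mono image_mono Sigma_mono) auto

lemma generator_in_graded_span: "b \<in> B \<Longrightarrow> i \<le> k \<Longrightarrow> z ^ i * b \<in> graded_span z B k"
  unfolding graded_span_def by (intro K.span_base) force

lemma card_generators_le:
  assumes "finite B"
  shows "card ((\<lambda>(i, b). z ^ i * b) ` ({..k} \<times> B)) \<le> (k + 1) * card B"
  using card_image_le[of "{..k} \<times> B" "\<lambda>(i, b). z ^ i * b"] assms
  by (simp add: card_cartesian_product)

lemma raisesI:
  assumes "\<And>i b. b \<in> B \<Longrightarrow> h * (z ^ i * b) \<in> graded_span z B (i + e)"
  shows "raises z B e h"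
  unfolding raises_def
proof (intro allI ballI)
  fix k v assume v: "v \<in> graded_span z B k"
  let ?W = "{v. h * v \<in> graded_span z B (k + e)}"
  have "K.subspace ?W"
    using subspace_graded_span[of z B "k + e"]
    by (auto simp: subspace_iff distrib_left mult.left_commute[of h])
  moreover have "(\<lambda>(i, b). z ^ i * b) ` ({..k} \<times> B) \<subseteq> ?W"
  proof clarsimp
    fix i b assume "i \<le> k" "b \<in> B"
    then show "h * (z ^ i * b) \<in> graded_span z B (k + e)"
      using assms[of b i] graded_span_mono[of "i + e" "k + e" z B] by auto
  qed
  ultimately show "h * v \<in> graded_span z B (k + e)"
    using v K.span_minimal unfolding graded_span_def by blast
qed

lemma raisesD: "raises z B e h \<Longrightarrow> v \<in> graded_span z B k \<Longrightarrow> h * v \<in> graded_span z B (k + e)"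
  by (auto simp: raises_def)

lemma raises_mono: "raises z B e h \<Longrightarrow> e \<le> e' \<Longrightarrow> raises z B e' h"
  unfolding raises_def by (meson add_left_mono graded_span_mono subsetD)

lemma raises_const: "raises z B 0 (\<iota> a)"
  using K.subspace_scale[OF subspace_graded_span] by (auto simp: raises_def)

lemma raises_base: "raises z B 1 z"
  using generator_in_graded_span by (intro raisesI) (simp flip: power_Suc mult.assoc)

lemma raises_add: "raises z B e g \<Longrightarrow> raises z B e h \<Longrightarrow> raises z B e (g + h)"
  using K.subspace_add[OF subspace_graded_span] by (auto simp: raises_def distrib_right)

lemma raises_mult:
  assumes "raises z B d g" "raises z B e h"
  shows "raises z B (d + e) (g * h)"
proof -
  have "g * h * v \<in> graded_span z B (k + (d + e))" if "v \<in> graded_span z B k" for k v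
    using raisesD[OF assms(1) raisesD[OF assms(2) that]] by (simp add: ac_simps)
  then show ?thesis by (auto simp: raises_def)
qed

lemma raises_power: "raises z B e h \<Longrightarrow> raises z B (m * e) (h ^ m)"
  by (induction m) (use raises_const[of z B 1] in \<open>auto intro: raises_mult\<close>)

lemma raises_poly: "\<exists>e. raises z B e (poly (map_poly \<iota> p) z)"
proof (induction p)
  case 0
  then show ?case using raises_const[of z B 0] by auto
next
  case (pCons a p)
  then obtain e where "raises z B e (poly (map_poly \<iota> p) z)" by blast
  then have "raises z B (1 + e) (\<iota> a + z * poly (map_poly \<iota> p) z)"
    by (intro raises_add raises_mono[OF raises_const] raises_mult raises_base) simp_all
  then show ?case
    using pCons by (auto simp: map_poly_pCons)
qed

text \<open>
  The denominator \<open>h\<close> itself has to raise degrees by a bounded amount only: its powers enter the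
  dimension count below.
\<close>

lemma clear_denominators:
  assumes "finite B" and c: "\<And>b. b \<in> B \<Longrightarrow> c b \<in> simple_extension \<iota> z" "B \<subseteq> B'"
  shows "\<exists>h e k. h \<noteq> 0 \<and> raises z B' e h \<and> h * (\<Sum>b\<in>B. c b * b) \<in> graded_span z B' k"
  using assms
proof (induction B rule: finite_induct)
  case empty
  then show ?case
    using raises_const[of z B' 1] K.subspace_0[OF subspace_graded_span, of z B' 0]
    by (intro exI[of _ 1] exI[of _ 0]) simp
next
  case (insert b B)
  then obtain h e k where h: "h \<noteq> 0" "raises z B' e h" "h * (\<Sum>b\<in>B. c b * b) \<in> graded_span z B' k"
    by auto
  obtain p r where pr: "c b = poly (map_poly \<iota> p) z / poly (map_poly \<iota> r) z" "poly (map_poly \<iota> r) z \<noteq> 0"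
    using insert.prems(1)[of b] by (auto simp: simple_extension_def)
  define f g where "f = poly (map_poly \<iota> p) z" and "g = poly (map_poly \<iota> r) z"
  obtain d d' where d: "raises z B' d f" "raises z B' d' g"
    unfolding f_def g_def using raises_poly by blast
  have fg: "c b = f / g" "g \<noteq> 0"
    using pr by (simp_all add: f_def g_def)
  let ?m = "max (d + e) (k + d')"
  have "h * f * b \<in> graded_span z B' ?m"
  proof -
    have "h * (f * (z ^ 0 * b)) \<in> graded_span z B' (0 + d + e)"
      using insert.prems by (intro raisesD[OF h(2)] raisesD[OF d(1)] generator_in_graded_span) auto
    then show ?thesis
      using graded_span_mono[of "d + e" ?m z B'] by (auto simp: mult.assoc)
  qed
  moreover have "g * (h * (\<Sum>b\<in>B. c b * b)) \<in> graded_span z B' ?m"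
    using raisesD[OF d(2) h(3)] graded_span_mono[of "k + d'" ?m z B'] by auto
  ultimately have "h * f * b + g * (h * (\<Sum>b\<in>B. c b * b)) \<in> graded_span z B' ?m"
    by (rule K.subspace_add[OF subspace_graded_span])
  also have "h * f * b + g * (h * (\<Sum>b\<in>B. c b * b)) = (h * g) * (\<Sum>b\<in>insert b B. c b * b)"
    using insert.hyps fg by (simp add: field_simps)
  finally show ?case
    using h d fg raises_mult[OF h(2) d(2)] by (intro exI[of _ "h * g"]) auto
qed

lemma common_denominator:
  assumes "finite Y" and single: "\<And>y. \<exists>h e k. h \<noteq> 0 \<and> raises z B e h \<and> h * y \<in> graded_span z B k"
  shows "\<exists>h e k. h \<noteq> 0 \<and> raises z B e h \<and> (\<forall>y\<in>Y. h * y \<in> graded_span z B k)"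
  using assms(1)
proof (induction Y rule: finite_induct)
  case empty
  show ?case using single[of 0] by blast
next
  case (insert y Y)
  then obtain h e k where h: "h \<noteq> 0" "raises z B e h" "\<forall>y\<in>Y. h * y \<in> graded_span z B k"
    by blast
  obtain g d l where g: "g \<noteq> 0" "raises z B d g" "g * y \<in> graded_span z B l"
    using single[of y] by blast
  let ?m = "max (k + d) (l + e)"
  have "g * h * w \<in> graded_span z B ?m" if "w \<in> Y" for w
    using raisesD[OF g(2), of "h * w" k] h(3) that graded_span_mono[of "k + d" ?m z B]
    by (auto simp: mult.assoc)
  moreover have "g * h * y \<in> graded_span z B ?m"
    using raisesD[OF h(2) g(3)] graded_span_mono[of "l + e" ?m z B]
    by (auto simp: ac_simps)
  ultimately show ?case
    using raises_mult[OF g(2) h(2)] g(1) h(1)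
    by (intro exI[of _ "g * h"]) auto
qed

text \<open>
  This is where the finiteness of \<open>F\<close> over a rational subfield \<open>K(z)\<close> enters. It says that \<open>F\<close> cannot
  contain arbitrarily many elements that are linearly independent over \<open>K[x]\<close>, for
  \<^emph>\<open>any\<close> \<open>x\<close>. Let \<open>h\<close> be a common denominator for multiplication by \<open>x\<close>, such that \<open>h\<close>
  and \<open>h x\<close> both raise degrees by at most \<open>e\<close>. After multiplication with \<open>h\<^sup>m\<close> and a common denominator of
  the \<open>y\<^sub>j\<close>, the \<open>m r\<close> elements \<open>x\<^sup>i y\<^sub>j\<close> with \<open>i < m\<close> and \<open>j < r\<close> lie in a space of dimension at most
  \<open>(k + m e + 1) card B\<close>, where \<open>k\<close> depends on the \<open>y\<^sub>j\<close> only. For \<open>r > e card B\<close> and large \<open>m\<close> there are more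
  elements than the dimension.
\<close>

theorem polynomially_independent_bounded:
  "\<exists>M. \<forall>r>M. \<forall>y :: nat \<Rightarrow> 'f. \<exists>m c. (\<exists>i<m. \<exists>j<r. c i j \<noteq> 0) \<and>
     (\<Sum>i<m. \<Sum>j<r. \<iota> (c i j) * (x ^ i * y j)) = 0"
proof -
  obtain z B where B: "finite B"
    and span: "\<And>y. \<exists>c. (\<forall>b\<in>B. c b \<in> simple_extension \<iota> z) \<and> y = (\<Sum>b\<in>B. c b * b)"
    using finite_over_rational_subfield by blast
  have single: "\<exists>h e k. h \<noteq> 0 \<and> raises z B e h \<and> h * y \<in> graded_span z B k" for y
    using span[of y] clear_denominators[OF B _ order_refl] by blast
  obtain h e1 e2 where h: "h \<noteq> 0" "raises z B e1 h" "\<And>b. b \<in> B \<Longrightarrow> h * (x * b) \<in> graded_span z B e2"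
    using common_denominator[OF finite_imageI[OF B, of "(*) x"] single] by blast
  have "raises z B e2 (h * x)"
  proof (rule raisesI)
    fix i b assume "b \<in> B"
    then have "z ^ i * (h * (x * b)) \<in> graded_span z B (e2 + i * 1)"
      by (intro raisesD raises_power raises_base h(3))
    then show "h * x * (z ^ i * b) \<in> graded_span z B (i + e2)"
      by (simp add: ac_simps)
  qed
  define e where "e = max e1 e2"
  have e: "raises z B e h" "raises z B e (h * x)"
    using h(2) \<open>raises z B e2 (h * x)\<close> by (auto simp: e_def intro: raises_mono)
  show ?thesis
  proof (rule exI[of _ "e * card B"], intro allI impI)
    fix r and y :: "nat \<Rightarrow> 'f"
    assume r: "e * card B < r"
    obtain g d k where g: "g \<noteq> 0" "\<And>j. j < r \<Longrightarrow> g * y j \<in> graded_span z B k"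
      using common_denominator[OF finite_imageI[OF finite_lessThan, of y r] single] by blast
    define m where "m = (k + 1) * card B + 1"
    define v where "v = (\<lambda>(i, j). (g * h ^ m) * (x ^ i * y j))"
    define T where "T = (\<lambda>(i, b). z ^ i * b) ` ({..k + m * e} \<times> B)"
    have span: "v ` ({..<m} \<times> {..<r}) \<subseteq> K.span T"
    proof clarify
      fix i j assume ij: "i < m" "j < r"
      \<comment> \<open>Writing \<open>h\<^sup>m x\<^sup>i\<close> as a product of \<open>m\<close> factors \<open>h\<close> or \<open>h x\<close> keeps the shift at \<open>m e\<close>.\<close>
      have "raises z B ((m - i) * e + i * e) (h ^ (m - i) * (h * x) ^ i)"
        using e by (intro raises_mult raises_power)
      then have "h ^ (m - i) * (h * x) ^ i * (g * y j) \<in> graded_span z B (k + ((m - i) * e + i * e))"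
        using g(2) ij by (intro raisesD)
      also have "h ^ (m - i) * (h * x) ^ i * (g * y j) = v (i, j)"
        using ij by (simp add: v_def power_mult_distrib flip: power_add)
      also have "(m - i) * e + i * e = m * e"
        using ij by (simp flip: distrib_right)
      finally show "v (i, j) \<in> K.span T"
        by (simp add: T_def graded_span_def)
    qed
    have card: "card T < card ({..<m} \<times> {..<r})"
    proof -
      have "card T \<le> (k + m * e + 1) * card B"
        unfolding T_def by (rule card_generators_le[OF B])
      also have "\<dots> = (k + 1) * card B + m * (e * card B)"
        by (simp add: algebra_simps)
      also have "\<dots> < m + m * (e * card B)"
        by (simp add: m_def)
      also have "\<dots> \<le> m * r"
        using mult_le_mono2[of "Suc (e * card B)" r m] r by simp
      finally show ?thesis
        by (simp add: card_cartesian_product)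
    qed
    have fin: "finite T"
      using B by (simp add: T_def)
    obtain c where c: "\<exists>p\<in>{..<m} \<times> {..<r}. c p \<noteq> 0"
      "(\<Sum>p\<in>{..<m} \<times> {..<r}. \<iota> (c p) * v p) = 0"
      using K.exists_nontrivial_relation[OF _ fin card span] by blast
    have "(\<Sum>p\<in>{..<m} \<times> {..<r}. \<iota> (c p) * v p) =
        (g * h ^ m) * (\<Sum>i<m. \<Sum>j<r. \<iota> (c (i, j)) * (x ^ i * y j))"
      by (simp add: v_def sum_distrib_left mult.left_commute sum.cartesian_product split_def)
    then have "(\<Sum>i<m. \<Sum>j<r. \<iota> (c (i, j)) * (x ^ i * y j)) = 0"
      using c(2) g(1) h(1) by simp
    then show "\<exists>m c. (\<exists>i<m. \<exists>j<r. c i j \<noteq> 0) \<and>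
        (\<Sum>i<m. \<Sum>j<r. \<iota> (c i j) * (x ^ i * y j)) = 0"
      using c(1) by (intro exI[of _ m] exI[of _ "\<lambda>i j. c (i, j)"]) auto
  qed
qed

end

section \<open>The ring of a place\<close>

locale function_field_place = function_field \<iota>
  for \<iota> :: "'k::field \<Rightarrow> 'f::field" +
  fixes P :: "'f set"
  assumes place: "is_place \<iota> P"
begin

abbreviation \<O> :: "'f set" where
  "\<O> \<equiv> place_ring P"

lemma valuation_ring: "is_valuation_ring \<iota> \<O>" and nonunits_ring: "nonunits \<O> = P"
proof -
  obtain R where "is_valuation_ring \<iota> R" "P = nonunits R"
    using place by (auto simp: is_place_def)
  then show "is_valuation_ring \<iota> \<O>" "nonunits \<O> = P"
    using place_ring_nonunits[of \<iota> R] by simp_all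
qed

lemma ring_add: "x \<in> \<O> \<Longrightarrow> y \<in> \<O> \<Longrightarrow> x + y \<in> \<O>"
  and ring_mult: "x \<in> \<O> \<Longrightarrow> y \<in> \<O> \<Longrightarrow> x * y \<in> \<O>"
  and ring_uminus: "x \<in> \<O> \<Longrightarrow> - x \<in> \<O>"
  and ring_const: "\<iota> c \<in> \<O>"
  and ring_or_inverse: "z \<in> \<O> \<or> inverse z \<in> \<O>"
  using valuation_ring unfolding is_valuation_ring_def by blast+

lemma ring_0: "0 \<in> \<O>" and ring_1: "1 \<in> \<O>"
  using ring_const[of 0] ring_const[of 1] by simp_all

lemma ring_power: "x \<in> \<O> \<Longrightarrow> x ^ m \<in> \<O>"
  by (induction m) (auto intro: ring_mult ring_1)

lemma place_iff: "x \<in> P \<longleftrightarrow> x \<in> \<O> \<and> (x = 0 \<or> inverse x \<notin> \<O>)"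
  using nonunits_ring by (auto simp: nonunits_def)

lemma place_subset_ring: "x \<in> P \<Longrightarrow> x \<in> \<O>"
  by (simp add: place_iff)

lemma place_0: "0 \<in> P"
  by (simp add: place_iff ring_0)

lemma place_mult:
  assumes "x \<in> \<O>" "y \<in> P"
  shows "x * y \<in> P"
proof (rule ccontr)
  assume n: "x * y \<notin> P"
  have "x * y \<in> \<O>"
    using assms place_subset_ring ring_mult by blast
  with n have nz: "x * y \<noteq> 0" "inverse (x * y) \<in> \<O>"
    by (auto simp: place_iff)
  then have "inverse (x * y) * x \<in> \<O>"
    using assms ring_mult by blast
  also have "inverse (x * y) * x = inverse y"
    using nz by (simp add: field_simps)
  finally show False
    using assms(2) nz by (auto simp: place_iff)
qed

lemma place_add:
  assumes "x \<in> P" "y \<in> P"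
  shows "x + y \<in> P"
proof -
  \<comment> \<open>One of the two quotients \<open>a / b\<close>, \<open>b / a\<close> lies in the ring.\<close>
  have aux: "a + b \<in> P" if "a \<in> P" "b \<in> P" "b \<noteq> 0" "a / b \<in> \<O>" for a b
  proof -
    have "(a / b + 1) * b \<in> P"
      using that by (intro place_mult ring_add ring_1)
    also have "(a / b + 1) * b = a + b"
      using that by (simp add: distrib_right)
    finally show ?thesis .
  qed
  show ?thesis
    using aux[of x y] aux[of y x] assms ring_or_inverse[of "x / y"]
    by (cases "x = 0 \<or> y = 0") (auto simp: add.commute)
qed

lemma place_uminus: "x \<in> P \<Longrightarrow> - x \<in> P"
  using place_mult[of "- 1" x] ring_uminus[OF ring_1] by simp

lemma place_diff: "x \<in> P \<Longrightarrow> y \<in> P \<Longrightarrow> x - y \<in> P"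
  using place_add[of x "- y"] place_uminus by simp

lemma const_in_place_iff: "\<iota> c \<in> P \<longleftrightarrow> c = 0"
  using ring_const[of "inverse c"] by (auto simp: place_iff ring_0 hom_inverse ring_const)

lemma one_notin_place: "1 \<notin> P"
  using const_in_place_iff[of 1] by simp

lemma subspace_place: "K.subspace P"
  by (auto simp: subspace_iff place_0 place_add place_mult ring_const)

lemma subspace_ring: "K.subspace \<O>"
  by (auto simp: subspace_iff ring_0 ring_add ring_mult ring_const)

lemma inverse_in_place: "z \<notin> \<O> \<Longrightarrow> inverse z \<in> P"
  using ring_or_inverse[of z] by (auto simp: place_iff)

lemma place_nonzero: "\<exists>x\<in>P. x \<noteq> 0"
proof -
  obtain z where "z \<notin> \<O>"
    using valuation_ring by (auto simp: is_valuation_ring_def)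
  then show ?thesis
    using inverse_in_place[of z] ring_0 by (intro bexI[of _ "inverse z"]) auto
qed


section \<open>Places are generated by one element\<close>

text \<open>
  A relation over \<open>K[x]\<close> can be divided by the highest power of \<open>x\<close> that divides all its
  coefficients. Afterwards the constant terms \<open>a\<^sub>j\<close> of the coefficients are not all zero.
\<close>

lemma relation_nontrivial_mod_x:
  assumes x: "x \<in> P" "x \<noteq> 0"
  shows "\<exists>M. \<forall>r>M. \<forall>y :: nat \<Rightarrow> 'f. \<exists>a g. (\<exists>j<r. a j \<noteq> 0) \<and> (\<forall>j. g j \<in> \<O>) \<and>
           (\<Sum>j<r. (\<iota> (a j) + x * g j) * y j) = 0"
proof -
  obtain M where M: "\<And>r (y :: nat \<Rightarrow> 'f). r > M \<Longrightarrow> \<exists>m c. (\<exists>i<m. \<exists>j<r. c i j \<noteq> 0) \<and>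
     (\<Sum>i<m. \<Sum>j<r. \<iota> (c i j) * (x ^ i * y j)) = 0"
    using polynomially_independent_bounded[of x] by blast
  show ?thesis
  proof (rule exI[of _ M], intro allI impI)
    fix r and y :: "nat \<Rightarrow> 'f" assume "r > M"
    then obtain m c where c: "\<exists>i<m. \<exists>j<r. c i j \<noteq> 0"
      and rel: "(\<Sum>i<m. \<Sum>j<r. \<iota> (c i j) * (x ^ i * y j)) = 0"
      using M by blast
    \<comment> \<open>\<open>x\<^sup>l\<close> is the highest power of \<open>x\<close> that divides all coefficients.\<close>
    define l where "l = (LEAST i. \<exists>j<r. c i j \<noteq> 0)"
    have l: "\<exists>j<r. c l j \<noteq> 0"
      unfolding l_def by (rule LeastI_ex) (use c in blast)
    have "l < m"
      using c Least_le[of "\<lambda>i. \<exists>j<r. c i j \<noteq> 0"] by (force simp: l_def)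
    then obtain k where k: "m = l + Suc k"
      using less_iff_Suc_add by auto
    have below: "c i j = 0" if "i < l" "j < r" for i j
      using not_less_Least[of i "\<lambda>i. \<exists>j<r. c i j \<noteq> 0"] that by (auto simp: l_def)
    have split: "(\<Sum>i<p + q. f i) = (\<Sum>i<p. f i) + (\<Sum>i<q. f (p + i))" for p q and f :: "nat \<Rightarrow> 'f"
      by (induction q) (simp_all add: add.assoc)
    define g where "g = (\<lambda>j. \<Sum>i<k. \<iota> (c (l + Suc i) j) * x ^ i)"
    have col: "(\<Sum>i<m. \<iota> (c i j) * (x ^ i * y j)) = x ^ l * ((\<iota> (c l j) + x * g j) * y j)" if "j < r" for j
    proof -
      have "(\<Sum>i<m. \<iota> (c i j) * (x ^ i * y j)) = (\<Sum>i<Suc k. \<iota> (c (l + i) j) * (x ^ (l + i) * y j))"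
        unfolding k split using below that by simp
      also have "\<dots> = x ^ l * ((\<iota> (c l j) + x * g j) * y j)"
        unfolding g_def sum.lessThan_Suc_shift
        by (simp add: sum_distrib_left sum_distrib_right power_add algebra_simps)
      finally show ?thesis .
    qed
    have "0 = (\<Sum>j<r. \<Sum>i<m. \<iota> (c i j) * (x ^ i * y j))"
      using rel by (subst sum.swap) simp
    also have "\<dots> = x ^ l * (\<Sum>j<r. (\<iota> (c l j) + x * g j) * y j)"
      unfolding sum_distrib_left by (rule sum.cong) (use col in auto)
    finally have "(\<Sum>j<r. (\<iota> (c l j) + x * g j) * y j) = 0"
      using x by simp
    moreover have "g j \<in> \<O>" for j
      unfolding g_def
      by (intro K.subspace_sum[OF subspace_ring] ring_mult ring_const ring_power place_subset_ring x)
    ultimately show "\<exists>a g. (\<exists>j<r. a j \<noteq> 0) \<and> (\<forall>j. g j \<in> \<O>) \<and>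
           (\<Sum>j<r. (\<iota> (a j) + x * g j) * y j) = 0"
      using l by (intro exI[of _ "c l"] exI[of _ g]) blast
  qed
qed

text \<open>
  In a chain \<open>y\<^sub>0 = x, y\<^sub>1, \<dots>\<close> the element \<open>y\<^sub>i\<close> lies in \<open>y\<^sub>j P\<close> for all \<open>i < j\<close>. A long chain satisfies a
  relation \<open>\<Sum>i. (a\<^sub>i + x g\<^sub>i) y\<^sub>i = 0\<close>. Let \<open>j\<close> be the last index with \<open>a\<^sub>j \<noteq> 0\<close> and divide by \<open>y\<^sub>j\<close>: the earlier
  terms lie in \<open>P\<close> by the chain condition, and the later ones because they contain the factor
  \<open>x/y\<^sub>j \<in> \<O>\<close>. Then \<open>a\<^sub>j \<in> P\<close>, although \<open>a\<^sub>j\<close> is a nonzero constant.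
\<close>

lemma chain_bounded:
  assumes x: "x \<in> P" "x \<noteq> 0"
  shows "\<exists>M. \<forall>r>M. \<forall>y. y 0 = x \<longrightarrow> (\<forall>i<r. y i \<in> P \<and> y i \<noteq> 0) \<longrightarrow>
           (\<exists>i. Suc i < r \<and> y i / y (Suc i) \<notin> P)"
proof -
  obtain M where M: "\<And>r (y :: nat \<Rightarrow> 'f). r > M \<Longrightarrow> \<exists>a g. (\<exists>j<r. a j \<noteq> 0) \<and> (\<forall>j. g j \<in> \<O>) \<and>
           (\<Sum>j<r. (\<iota> (a j) + x * g j) * y j) = 0"
    using relation_nontrivial_mod_x[OF x] by blast
  show ?thesis
  proof (rule exI[of _ M], intro allI impI)
    fix r y assume r: "r > M" and y0: "y 0 = x" and y: "\<forall>i<r. y i \<in> P \<and> y i \<noteq> 0"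
    show "\<exists>i. Suc i < r \<and> y i / y (Suc i) \<notin> P"
    proof (rule ccontr)
      assume "\<not> ?thesis"
      then have step: "y i / y (Suc i) \<in> P" if "Suc i < r" for i
        using that by blast
      have quot: "y i / y j \<in> P" if "i < j" "j < r" for i j
        using that
      proof (induction j)
        case (Suc j)
        then have "y i / y j * (y j / y (Suc j)) \<in> P" if "i < j"
          using that by (intro place_mult place_subset_ring[OF Suc.IH] step) auto
        then show ?case
          using Suc.prems step y by (cases "i = j") auto
      qed simp
      obtain a g where ag: "\<exists>j<r. a j \<noteq> 0" "\<And>j. g j \<in> \<O>"
        and rel: "(\<Sum>j<r. (\<iota> (a j) + x * g j) * y j) = 0"
        using M[OF r, of y] by blast
      define j where "j = (GREATEST j. j < r \<and> a j \<noteq> 0)"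
      have "j < r \<and> a j \<noteq> 0"
        unfolding j_def by (rule GreatestI_ex_nat[of _ r]) (use ag in auto)
      then have j: "j < r" "a j \<noteq> 0" by auto
      have above: "a i = 0" if "j < i" "i < r" for i
        using Greatest_le_nat[of "\<lambda>j. j < r \<and> a j \<noteq> 0" i r] that by (auto simp: j_def)
      have xg: "x * g i \<in> P" for i
        using place_mult[OF ag(2) x(1)] by (simp add: mult.commute)
      have others: "(\<iota> (a i) + x * g i) * y i / y j \<in> P" if i: "i < r" "i \<noteq> j" for i
      proof (cases "i < j")
        case True
        then show ?thesis
          using place_mult[OF ring_add[OF ring_const[of "a i"] place_subset_ring[OF xg[of i]]] quot[of i j]] j
          by simp
      next
        case False
        have "x / y j \<in> \<O>"
          using y0 x(2) quot[of 0 j] j(1) ring_1 place_subset_ring by (cases "j = 0") auto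
        then have "(g i * (x / y j)) * y i \<in> P"
          using ag(2) y i by (intro place_mult ring_mult) auto
        then show ?thesis
          using above[of i] False i by (simp add: ac_simps)
      qed
      define S where "S = (\<Sum>i\<in>{..<r} - {j}. (\<iota> (a i) + x * g i) * y i / y j)"
      have "0 = (\<Sum>i<r. (\<iota> (a i) + x * g i) * y i / y j)"
        using rel by (simp flip: sum_divide_distrib)
      also have "\<dots> = (\<iota> (a j) + x * g j) * y j / y j + S"
        unfolding S_def using j by (intro sum.remove) auto
      also have "(\<iota> (a j) + x * g j) * y j / y j = \<iota> (a j) + x * g j"
        using y j by simp
      finally have "\<iota> (a j) = - (x * g j) - S"
        by (simp add: eq_diff_eq eq_neg_iff_add_eq_0 ac_simps)
      also have "\<dots> \<in> P"
        unfolding S_def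
        by (intro place_diff place_uminus xg K.subspace_sum[OF subspace_place] others) auto
      finally show False
        using j by (simp add: const_in_place_iff)
    qed
  qed
qed

lemma prime_element_iff: "prime_element P t \<longleftrightarrow> t \<in> P \<and> t \<noteq> 0 \<and> (\<forall>p\<in>P. p / t \<in> \<O>)"
proof
  assume t: "prime_element P t"
  then have eq: "P = {t * y | y. y \<in> \<O>}" by (simp add: prime_element_def)
  have "t * 1 \<in> P"
    using eq ring_1 by blast
  moreover have "t \<noteq> 0"
    using eq place_nonzero by auto
  moreover have "p / t \<in> \<O>" if "p \<in> P" for p
  proof -
    have "p \<in> {t * y | y. y \<in> \<O>}"
      using that eq by blast
    then show ?thesis
      using \<open>t \<noteq> 0\<close> by auto
  qed
  ultimately show "t \<in> P \<and> t \<noteq> 0 \<and> (\<forall>p\<in>P. p / t \<in> \<O>)"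
    by simp
next
  assume t: "t \<in> P \<and> t \<noteq> 0 \<and> (\<forall>p\<in>P. p / t \<in> \<O>)"
  then have "p \<in> {t * y | y. y \<in> \<O>}" if "p \<in> P" for p
    using that by (auto intro!: exI[of _ "p / t"])
  moreover have "t * y \<in> P" if "y \<in> \<O>" for y
    using that t place_mult[of y t] by (simp add: mult.commute)
  ultimately show "prime_element P t"
    unfolding prime_element_def by blast
qed

text \<open>
  If no \<open>t\<close> generates \<open>P\<close>, each nonzero \<open>t \<in> P\<close> lies in \<open>s P\<close> for another \<open>s \<in> P\<close>, and iterating this gives an
  infinite chain.
\<close>

lemma prime_element_exists: "\<exists>t. prime_element P t"
proof (rule ccontr)
  assume none: "\<not> ?thesis"
  obtain x where x: "x \<in> P" "x \<noteq> 0"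
    using place_nonzero by blast
  have step: "\<exists>s. (s \<in> P \<and> s \<noteq> 0) \<and> t / s \<in> P" if t: "t \<in> P \<and> t \<noteq> 0" for t
  proof -
    obtain s where s: "s \<in> P" "s / t \<notin> \<O>"
      using none t by (auto simp: prime_element_iff)
    then have "s \<noteq> 0" using ring_0 by auto
    then show ?thesis
      using s inverse_in_place[OF s(2)] by auto
  qed
  have "\<exists>y. \<forall>i. (y i \<in> P \<and> y i \<noteq> 0 \<and> (i = 0 \<longrightarrow> y i = x)) \<and> y i / y (Suc i) \<in> P"
    by (rule dependent_nat_choice) (use x step in auto)
  then obtain y where y: "\<And>i. y i \<in> P \<and> y i \<noteq> 0" "y 0 = x" "\<And>i. y i / y (Suc i) \<in> P"
    by blast
  then show False
    using chain_bounded[OF x] by blast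
qed

lemma unit_iff: "u \<in> \<O> - P \<longleftrightarrow> u \<noteq> 0 \<and> u \<in> \<O> \<and> inverse u \<in> \<O>"
  by (auto simp: place_iff)

lemma unit_inverse: "u \<in> \<O> - P \<Longrightarrow> inverse u \<in> \<O> - P"
  unfolding unit_iff by auto

lemma unit_mult: "u \<in> \<O> - P \<Longrightarrow> w \<in> \<O> - P \<Longrightarrow> u * w \<in> \<O> - P"
  unfolding unit_iff by (auto simp: ring_mult)

lemma unit_power_int: "u \<in> \<O> - P \<Longrightarrow> u powi m \<in> \<O> - P"
  unfolding unit_iff power_int_def by (auto simp: ring_power simp flip: power_inverse)

text \<open>
  If \<open>z\<close> were divisible by every power of \<open>t\<close>, the chains \<open>z, t\<^sup>r\<^sup>-\<^sup>1, \<dots>, t\<close> would be arbitrarily long.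
\<close>

lemma prime_factorization_ring:
  assumes t: "prime_element P t" and z: "z \<in> \<O>" "z \<noteq> 0"
  shows "\<exists>m. z / t ^ m \<in> \<O> - P"
proof (rule ccontr)
  assume none: "\<not> ?thesis"
  have t': "t \<in> P" "t \<noteq> 0" "\<And>p. p \<in> P \<Longrightarrow> p / t \<in> \<O>"
    using t by (auto simp: prime_element_iff)
  have "z / t ^ m \<in> \<O>" for m
  proof (induction m)
    case (Suc m)
    then have "z / t ^ m / t \<in> \<O>"
      using none by (intro t') auto
    then show ?case by (simp add: mult.commute)
  qed (use z in simp)
  then have div: "z / t ^ m \<in> P" for m
    using none by blast
  have zP: "z \<in> P"
    using div[of 0] by simp
  obtain M where M: "\<And>r (y :: nat \<Rightarrow> 'f). r > M \<Longrightarrow> y 0 = z \<Longrightarrow> (\<forall>i<r. y i \<in> P \<and> y i \<noteq> 0) \<Longrightarrow>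
           (\<exists>i. Suc i < r \<and> y i / y (Suc i) \<notin> P)"
    using chain_bounded[OF zP z(2)] by blast
  define r where "r = M + 1"
  define y where "y = (\<lambda>i. if i = 0 then z else t ^ (r - i))"
  have pow: "t ^ Suc m \<in> P" for m
    using place_mult[OF ring_power[OF place_subset_ring[OF t'(1)]] t'(1), of m]
    by (simp add: mult.commute)
  have "\<forall>i<r. y i \<in> P \<and> y i \<noteq> 0"
  proof (intro allI impI)
    fix i assume "i < r"
    then obtain k where "r - i = Suc k"
      using Suc_diff_Suc by metis
    then show "y i \<in> P \<and> y i \<noteq> 0"
      using zP z(2) pow[of k] t'(2) by (simp add: y_def)
  qed
  then obtain i where i: "Suc i < r" "y i / y (Suc i) \<notin> P"
    using M[of r y] by (auto simp: y_def r_def)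
  moreover have "r - i = Suc (r - Suc i)"
    using i(1) by simp
  ultimately show False
    using div[of "r - 1"] t'(1,2) by (cases "i = 0") (auto simp: y_def)
qed

lemma prime_factorization:
  assumes t: "prime_element P t" and "z \<noteq> 0"
  shows "\<exists>m u. u \<in> \<O> - P \<and> z = t powi m * u"
proof -
  have t0: "t \<noteq> 0" using t by (auto simp: prime_element_iff)
  show ?thesis
  proof (cases "z \<in> \<O>")
    case True
    then obtain m where "z / t ^ m \<in> \<O> - P"
      using prime_factorization_ring[OF t] assms(2) by blast
    then show ?thesis
      using t0 by (intro exI[of _ "int m"] exI[of _ "z / t ^ m"]) (auto simp: power_int_def)
  next
    case False
    then obtain m where m: "inverse z / t ^ m \<in> \<O> - P"
      using prime_factorization_ring[OF t, of "inverse z"] assms(2) place_subset_ring[OF inverse_in_place]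
      by auto
    show ?thesis
      using unit_inverse[OF m] t0
      by (intro exI[of _ "- int m"] exI[of _ "inverse (inverse z / t ^ m)"])
         (auto simp: power_int_minus field_simps)
  qed
qed

lemma prime_power_times_unit_in_ring_iff:
  assumes t: "prime_element P t" and u: "u \<in> \<O> - P"
  shows "t powi d * u \<in> \<O> \<longleftrightarrow> 0 \<le> d"
proof
  have t': "t \<in> P" "t \<noteq> 0"
    using t by (auto simp: prime_element_iff)
  show "0 \<le> d" if "t powi d * u \<in> \<O>"
  proof (rule ccontr)
    assume "\<not> 0 \<le> d"
    then obtain k where k: "d = - int (Suc k)"
      by (metis not_le negD)
    have "t ^ k * (t powi d * u) * t \<in> P"
      by (intro place_mult[OF _ t'(1)] ring_mult ring_power that place_subset_ring[OF t'(1)])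
    also have "t ^ k * (t powi d * u) * t = u"
      using t' unfolding k power_int_minus by (simp del: of_nat_Suc add: field_simps)
    finally show False using u by simp
  qed
  show "t powi d * u \<in> \<O>" if "0 \<le> d"
    using that u place_subset_ring[OF t'(1)] by (auto simp: power_int_def ring_mult ring_power)
qed

text \<open>
  Two prime elements differ by a unit, so the exponent does not depend on the prime element and the
  description that defines the valuation is satisfied by exactly one integer.
\<close>

lemma valuation_eq:
  assumes t: "prime_element P t" and u: "u \<in> \<O> - P"
  shows "valuation P (t powi m * u) = m"
  unfolding valuation_def
proof (rule the_equality)
  show "\<exists>t' u'. prime_element P t' \<and> u' \<in> \<O> - P \<and> t powi m * u = t' powi m * u'"
    using t u by blast
next
  fix k assume "\<exists>s w. prime_element P s \<and> w \<in> \<O> - P \<and> t powi m * u = s powi k * w"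
  then obtain s w where s: "prime_element P s" and w: "w \<in> \<O> - P"
    and eq: "t powi m * u = s powi k * w" by blast
  have nz: "s \<noteq> 0" "t \<noteq> 0" "u \<noteq> 0" "w \<noteq> 0"
    using s t u w place_0 by (auto simp: prime_element_iff)
  have "s / t \<in> \<O> - P"
    using s t unfolding unit_iff by (auto simp: prime_element_iff)
  then have unit: "(s / t) powi k * w * inverse u \<in> \<O> - P" (is "?e \<in> _")
    using u w by (intro unit_mult unit_power_int unit_inverse)
  have "t powi m = t powi k * ?e"
    using eq nz by (simp add: field_simps power_int_divide_distrib)
  then have "t powi (m - k) = ?e"
    using nz by (simp add: power_int_diff)
  then have "t powi (m - k) \<in> \<O> - P"
    using unit by simp
  moreover from this have "inverse (t powi (m - k)) \<in> \<O> - P"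
    by (rule unit_inverse)
  then have "t powi (k - m) \<in> \<O> - P"
    using power_int_minus[of t "m - k"] by simp
  ultimately have "t powi (m - k) * 1 \<in> \<O>" "t powi (k - m) * 1 \<in> \<O>"
    by simp_all
  moreover have "1 \<in> \<O> - P"
    using ring_1 one_notin_place by simp
  ultimately show "k = m"
    using prime_power_times_unit_in_ring_iff[OF t, of 1 "m - k"]
      prime_power_times_unit_in_ring_iff[OF t, of 1 "k - m"] by simp
qed

text \<open>
  This trades inequalities between valuations for membership in the ring. That Riemann--Roch spaces
  are closed under sums and multiply into each other then follows from the same properties of \<open>\<O>\<close>.
\<close>

lemma valuation_ge_iff:
  assumes t: "prime_element P t" and "z \<noteq> 0"
  shows "m \<le> valuation P z \<longleftrightarrow> t powi (- m) * z \<in> \<O>"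
proof -
  obtain k u where u: "u \<in> \<O> - P" and z: "z = t powi k * u"
    using prime_factorization[OF assms] by blast
  have "t \<noteq> 0" using t by (auto simp: prime_element_iff)
  then have "t powi (- m) * z = t powi (k - m) * u"
    by (simp add: z power_int_diff power_int_minus field_simps)
  moreover have "valuation P z = k"
    unfolding z by (rule valuation_eq[OF t u])
  ultimately show ?thesis
    using prime_power_times_unit_in_ring_iff[OF t u, of "k - m"] by simp
qed

section \<open>Residue class fields are finite-dimensional\<close>

text \<open>
  For \<open>y\<^sub>j \<in> \<O>\<close>, a relation \<open>\<Sum>j. (a\<^sub>j + x g\<^sub>j) y\<^sub>j = 0\<close> with \<open>x \<in> P\<close> reduces to the relation with the coefficients
  \<open>a\<^sub>j\<close> between the residue classes of the \<open>y\<^sub>j\<close>.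
\<close>

lemma independent_mod_place_bounded:
  "\<exists>M. \<forall>bs. set bs \<subseteq> \<O> \<longrightarrow> independent_mod P bs \<longrightarrow> length bs \<le> M"
proof -
  obtain x where x: "x \<in> P" "x \<noteq> 0"
    using place_nonzero by blast
  obtain M where M: "\<And>r (y :: nat \<Rightarrow> 'f). r > M \<Longrightarrow> \<exists>a g. (\<exists>j<r. a j \<noteq> 0) \<and> (\<forall>j. g j \<in> \<O>) \<and>
           (\<Sum>j<r. (\<iota> (a j) + x * g j) * y j) = 0"
    using relation_nontrivial_mod_x[OF x] by blast
  have "length bs \<le> M" if bs: "set bs \<subseteq> \<O>" "independent_mod P bs" for bs
  proof (rule ccontr)
    assume "\<not> length bs \<le> M"
    then obtain a g where ag: "\<exists>j<length bs. a j \<noteq> 0" "\<And>j. g j \<in> \<O>"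
      and rel: "(\<Sum>j<length bs. (\<iota> (a j) + x * g j) * bs ! j) = 0"
      using M[of "length bs" "(!) bs"] by (auto simp: not_le)
    have "lin_comb \<iota> (vec (length bs) a) bs = - (\<Sum>j<length bs. (g j * bs ! j) * x)"
      using rel by (simp add: lin_comb_def algebra_simps sum.distrib eq_neg_iff_add_eq_0)
    also have "\<dots> \<in> P"
      using bs(1) ag(2) x(1)
      by (intro place_uminus K.subspace_sum[OF subspace_place] place_mult ring_mult) auto
    finally have "vec (length bs) a = 0\<^sub>v (length bs)"
      by (intro independent_modD[OF bs(2)]) simp_all
    then show False
      using ag(1) by (auto simp: vec_eq_iff)
  qed
  then show ?thesis by blast
qed

lemma residue_class_eq_iff: "residue_class P z = residue_class P w \<longleftrightarrow> z - w \<in> P"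
proof
  assume "residue_class P z = residue_class P w"
  moreover have "z \<in> residue_class P z"
    by (simp add: residue_class_def place_0)
  ultimately show "z - w \<in> P"
    by (auto simp: residue_class_def)
next
  assume zw: "z - w \<in> P"
  show "residue_class P z = residue_class P w"
    using place_add[OF _ zw] place_diff[OF _ zw] by (force simp: residue_class_def)
qed

lemma residue_basis_iff:
  "residue_basis \<iota> P bs \<longleftrightarrow> set bs \<subseteq> \<O> \<and> independent_mod P bs \<and>
     (\<forall>w\<in>\<O>. \<exists>c\<in>carrier_vec (length bs). w - lin_comb \<iota> c bs \<in> P)"
proof -
  have "(\<forall>x\<in>residue_field P. \<exists>!c. is_residue_coords \<iota> P bs x c) \<longleftrightarrow>
      (\<forall>w\<in>\<O>. \<exists>!c. c \<in> carrier_vec (length bs) \<and> w - lin_comb \<iota> c bs \<in> P)"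
    by (simp add: residue_field_def is_residue_coords_def residue_class_eq_iff)
  also have "\<dots> \<longleftrightarrow> independent_mod P bs \<and>
     (\<forall>w\<in>\<O>. \<exists>c\<in>carrier_vec (length bs). w - lin_comb \<iota> c bs \<in> P)" (is "?L \<longleftrightarrow> ?I \<and> ?S")
  proof (intro iffI conjI)
    assume L: ?L
    then show ?S by blast
    show ?I
      unfolding independent_mod_def
    proof (intro ballI impI)
      fix c assume c: "c \<in> carrier_vec (length bs)" "lin_comb \<iota> c bs \<in> P"
      then have "0 - lin_comb \<iota> c bs \<in> P" "0 - lin_comb \<iota> (0\<^sub>v (length bs)) bs \<in> P"
        using place_uminus place_0 by auto
      then show "c = 0\<^sub>v (length bs)"
        using L ring_0 c(1) zero_carrier_vec by blast
    qed
  next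
    assume IS: "?I \<and> ?S"
    show ?L
    proof (intro ballI ex_ex1I)
      fix w c d
      assume c: "c \<in> carrier_vec (length bs) \<and> w - lin_comb \<iota> c bs \<in> P"
        and d: "d \<in> carrier_vec (length bs) \<and> w - lin_comb \<iota> d bs \<in> P"
      have "lin_comb \<iota> (c - d) bs = (w - lin_comb \<iota> d bs) - (w - lin_comb \<iota> c bs)"
        using c d by (simp add: lin_comb_diff)
      also have "\<dots> \<in> P"
        using c d place_diff by blast
      finally have "c - d = 0\<^sub>v (length bs)"
        using IS c d by (intro independent_modD) auto
      then have "\<forall>i<length bs. (c - d) $ i = 0"
        by simp
      then show "c = d"
        using c d by (auto simp: vec_eq_iff)
    qed (use IS in blast)
  qed
  finally show ?thesis
    by (simp add: residue_basis_def)
qed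

lemma residue_basis_length_le:
  assumes "residue_basis \<iota> P cs" "set bs \<subseteq> \<O>" "independent_mod P bs"
  shows "length bs \<le> length cs"
proof -
  have "length bs \<le> card (set cs)"
  proof (rule independent_mod_length_le[OF subspace_place assms(3)])
    fix b assume "b \<in> set bs"
    then obtain c where "c \<in> carrier_vec (length cs)" "b - lin_comb \<iota> c cs \<in> P"
      using assms(1,2) unfolding residue_basis_iff by blast
    then show "\<exists>w\<in>K.span (set cs). b - w \<in> P"
      using in_span_list_iff by blast
  qed simp
  then show ?thesis
    using card_length[of cs] by simp
qed

lemma residue_basis_exists: "\<exists>bs. residue_basis \<iota> P bs"
proof -
  obtain M where "\<And>bs. set bs \<subseteq> \<O> \<Longrightarrow> independent_mod P bs \<Longrightarrow> length bs \<le> M"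
    using independent_mod_place_bounded by blast
  then show ?thesis
    by (rule exists_basis_mod[OF subspace_place]) (auto simp: residue_basis_iff)
qed

lemma place_degree_eq: "residue_basis \<iota> P bs \<Longrightarrow> place_degree \<iota> P = length bs"
  unfolding place_degree_def
  by (intro the_equality) (auto intro!: antisym residue_basis_length_le simp: residue_basis_iff)

lemma independent_mod_place_length_le:
  "set bs \<subseteq> \<O> \<Longrightarrow> independent_mod P bs \<Longrightarrow> length bs \<le> place_degree \<iota> P"
  using residue_basis_exists residue_basis_length_le place_degree_eq by metis

text \<open>
  Over a place of degree one the classes of \<open>f\<close> and \<open>1\<close> are linearly dependent, and the class of \<open>1\<close> is
  nonzero.
\<close>

lemma rational_place_residue:
  assumes "place_degree \<iota> P = 1" "f \<in> \<O>"
  shows "\<exists>c. f - \<iota> c \<in> P"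
proof (rule ccontr)
  assume none: "\<not> ?thesis"
  have "independent_mod P [1]"
    using independent_mod_Cons[OF subspace_place independent_mod_Nil, of 1] one_notin_place by simp
  then have "independent_mod P [f, 1]"
    using none independent_mod_Cons[OF subspace_place, of "[1]" f] by (auto simp: lin_comb_def)
  then show False
    using independent_mod_place_length_le[of "[f, 1]"] assms ring_1 by simp
qed

lemma eval_at_eq_iff:
  assumes "place_degree \<iota> P = 1" "f \<in> \<O>"
  shows "eval_at \<iota> P f = c \<longleftrightarrow> f - \<iota> c \<in> P"
proof -
  have unique: "c = d" if "f - \<iota> c \<in> P" "f - \<iota> d \<in> P" for c d
    using place_diff[OF that] const_in_place_iff[of "d - c"] by (simp add: hom_minus)
  have "f - \<iota> (eval_at \<iota> P f) \<in> P"
    unfolding eval_at_def residue_class_eq_iff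
    by (rule theI') (use rational_place_residue[OF assms] unique in blast)
  then show ?thesis
    using unique by blast
qed

end

section \<open>Riemann--Roch spaces\<close>

context function_field_place
begin

lemma eval_at_lin_comb:
  assumes "place_degree \<iota> P = 1" "set bs \<subseteq> \<O>"
  shows "eval_at \<iota> P (lin_comb \<iota> c bs) = (\<Sum>j<length bs. c $ j * eval_at \<iota> P (bs ! j))"
proof -
  let ?e = "\<lambda>j. eval_at \<iota> P (bs ! j)"
  have "(\<Sum>j<length bs. \<iota> (c $ j) * (bs ! j - \<iota> (?e j))) \<in> P"
  proof (intro K.subspace_sum[OF subspace_place] place_mult ring_const)
    fix j assume "j \<in> {..<length bs}"
    then have "bs ! j \<in> \<O>" using assms(2) by auto
    then show "bs ! j - \<iota> (?e j) \<in> P"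
      using eval_at_eq_iff[OF assms(1)] by blast
  qed
  also have "(\<Sum>j<length bs. \<iota> (c $ j) * (bs ! j - \<iota> (?e j)))
      = lin_comb \<iota> c bs - \<iota> (\<Sum>j<length bs. c $ j * ?e j)"
    by (simp add: lin_comb_def right_diff_distrib sum_subtractf hom_sum hom_mult)
  finally show ?thesis
    using eval_at_eq_iff[OF assms(1) lin_comb_in_subspace[OF subspace_ring assms(2)]] by blast
qed

lemma eval_at_mult_eq_0:
  assumes "place_degree \<iota> P = 1" "f \<in> \<O>" "g \<in> \<O>" "eval_at \<iota> P f = 0"
  shows "eval_at \<iota> P (f * g) = 0"
  using assms eval_at_eq_iff[OF assms(1,2), of 0] eval_at_eq_iff[OF assms(1) ring_mult[OF assms(2,3)], of 0]
    place_mult[of g f] by (simp add: mult.commute)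

end

context function_field
begin

lemma function_field_place: "is_place \<iota> P \<Longrightarrow> function_field_place \<iota> P"
  by unfold_locales

lemma RR_spaceD:
  assumes "f \<in> RR_space A" "is_place \<iota> P" "prime_element P t"
  shows "t powi Poly_Mapping.lookup A P * f \<in> place_ring P"
proof -
  interpret place: function_field_place \<iota> P
    using assms(2) by (rule function_field_place)
  show ?thesis
    using assms place.valuation_ge_iff[OF assms(3), of f "- Poly_Mapping.lookup A P"] place.ring_0
    by (cases "f = 0") (auto simp: RR_space_def)
qed

lemma RR_spaceI:
  assumes "\<And>P. is_place \<iota> P \<Longrightarrow> \<exists>t. prime_element P t \<and> t powi Poly_Mapping.lookup A P * f \<in> place_ring P"
  shows "f \<in> RR_space A"
proof -
  have "- Poly_Mapping.lookup A P \<le> valuation P f" if P: "is_place \<iota> P" "f \<noteq> 0" for P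
  proof -
    interpret place: function_field_place \<iota> P
      using P(1) by (rule function_field_place)
    show ?thesis
      using assms[OF P(1)] place.valuation_ge_iff[OF _ P(2), of _ "- Poly_Mapping.lookup A P"] by auto
  qed
  then show ?thesis
    by (auto simp: RR_space_def)
qed

lemma prime_element_exists: "is_place \<iota> P \<Longrightarrow> \<exists>t. prime_element P t"
  using function_field_place function_field_place.prime_element_exists by blast

lemma subspace_RR_space: "K.subspace (RR_space A)"
  unfolding subspace_iff
proof (intro conjI ballI allI)
  show "0 \<in> RR_space A" by (simp add: RR_space_def)
next
  fix f g assume fg: "f \<in> RR_space A" "g \<in> RR_space A"
  show "f + g \<in> RR_space A"
  proof (rule RR_spaceI)
    fix P assume P: "is_place \<iota> P"
    then obtain t where t: "prime_element P t"
      using prime_element_exists by blast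
    interpret place: function_field_place \<iota> P
      using P by (rule function_field_place)
    show "\<exists>t. prime_element P t \<and> t powi Poly_Mapping.lookup A P * (f + g) \<in> place_ring P"
      using t place.ring_add[OF fg[THEN RR_spaceD[OF _ P t]]] by (auto simp: distrib_left)
  qed
next
  fix c f assume f: "f \<in> RR_space A"
  show "\<iota> c * f \<in> RR_space A"
  proof (rule RR_spaceI)
    fix P assume P: "is_place \<iota> P"
    then obtain t where t: "prime_element P t"
      using prime_element_exists by blast
    interpret place: function_field_place \<iota> P
      using P by (rule function_field_place)
    show "\<exists>t. prime_element P t \<and> t powi Poly_Mapping.lookup A P * (\<iota> c * f) \<in> place_ring P"
      using t place.ring_mult[OF place.ring_const RR_spaceD[OF f P t]] by (auto simp: mult.left_commute)
  qed
qed

lemma RR_space_mult: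
  assumes "f \<in> RR_space A" "g \<in> RR_space B"
  shows "f * g \<in> RR_space (A + B)"
proof (rule RR_spaceI)
  fix P assume P: "is_place \<iota> P"
  then obtain t where t: "prime_element P t"
    using prime_element_exists by blast
  interpret place: function_field_place \<iota> P
    using P by (rule function_field_place)
  have "t \<noteq> 0"
    using t by (simp add: place.prime_element_iff)
  then have eq: "t powi Poly_Mapping.lookup (A + B) P * (f * g) =
      (t powi Poly_Mapping.lookup A P * f) * (t powi Poly_Mapping.lookup B P * g)"
    by (simp add: lookup_add power_int_add ac_simps)
  show "\<exists>t. prime_element P t \<and> t powi Poly_Mapping.lookup (A + B) P * (f * g) \<in> place_ring P"
    by (intro exI[of _ t] conjI t)
      (simp only: eq place.ring_mult RR_spaceD[OF assms(1) P t] RR_spaceD[OF assms(2) P t])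
qed

lemma RR_space_mono:
  assumes "\<And>P. Poly_Mapping.lookup A P \<le> Poly_Mapping.lookup B P"
  shows "RR_space A \<subseteq> RR_space B"
proof
  fix f assume f: "f \<in> RR_space A"
  show "f \<in> RR_space B"
    unfolding RR_space_def
  proof (clarsimp)
    fix P assume "f \<noteq> 0" "is_place \<iota> P"
    then have "- Poly_Mapping.lookup A P \<le> valuation P f"
      using f by (auto simp: RR_space_def)
    then show "- Poly_Mapping.lookup B P \<le> valuation P f"
      using assms[of P] by simp
  qed
qed

lemma RR_space_subset_place_ring:
  assumes "is_place \<iota> P" "P \<notin> Poly_Mapping.keys A"
  shows "RR_space A \<subseteq> place_ring P"
proof
  fix f assume f: "f \<in> RR_space A"
  obtain t where t: "prime_element P t"
    using prime_element_exists[OF assms(1)] by blast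
  have "Poly_Mapping.lookup A P = 0"
    using assms(2) by (simp add: in_keys_iff)
  then show "f \<in> place_ring P"
    using RR_spaceD[OF f assms(1) t] by simp
qed

text \<open>
  Let \<open>a\<close> be the coefficient of \<open>P\<close> in \<open>A\<close>. Multiplication by \<open>t\<^sup>a\<^sup>+\<^sup>1\<close> maps \<open>\<L>(A + P)\<close> into the ring of \<open>P\<close>, and
  exactly \<open>\<L>(A)\<close> into \<open>P\<close>. So \<open>\<L>(A + P)/\<L>(A)\<close> embeds into the residue class field.
\<close>

lemma independent_mod_RR_space_length_le:
  assumes P: "is_place \<iota> P" and fs: "set fs \<subseteq> RR_space (A + place_divisor P)"
    and ind: "independent_mod (RR_space A) fs"
  shows "length fs \<le> place_degree \<iota> P"
proof -
  interpret place: function_field_place \<iota> P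
    using P by (rule function_field_place)
  obtain t where t: "prime_element P t"
    using prime_element_exists[OF P] by blast
  then have t': "t \<noteq> 0" "\<And>p. p \<in> P \<Longrightarrow> p / t \<in> place_ring P"
    by (auto simp: place.prime_element_iff)
  let ?a = "Poly_Mapping.lookup A P"
  let ?gs = "map ((*) (t powi (?a + 1))) fs"
  have "set ?gs \<subseteq> place_ring P"
    using fs RR_spaceD[OF _ P t, of _ "A + place_divisor P"] by (auto simp: lookup_add)
  moreover have "independent_mod P ?gs"
    unfolding independent_mod_def
  proof (intro ballI impI)
    fix c assume c: "c \<in> carrier_vec (length ?gs)" "lin_comb \<iota> c ?gs \<in> P"
    let ?f = "lin_comb \<iota> c fs"
    have f: "?f \<in> RR_space (A + place_divisor P)"
      by (rule lin_comb_in_subspace[OF subspace_RR_space fs])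
    have "t powi (?a + 1) * ?f / t \<in> place_ring P"
      using c(2) t'(2) by (simp add: lin_comb_map_mult)
    also have "t powi (?a + 1) * ?f / t = t powi ?a * ?f"
      using t'(1) by (simp add: power_int_add)
    finally have at_P: "t powi ?a * ?f \<in> place_ring P" .
    have "?f \<in> RR_space A"
    proof (rule RR_spaceI)
      fix R assume R: "is_place \<iota> R"
      show "\<exists>s. prime_element R s \<and> s powi Poly_Mapping.lookup A R * ?f \<in> place_ring R"
      proof (cases "R = P")
        case True
        then show ?thesis using t at_P by blast
      next
        case False
        obtain s where "prime_element R s"
          using prime_element_exists[OF R] by blast
        then show ?thesis
          using RR_spaceD[OF f R, of s] False by (auto simp: lookup_add lookup_single_not_eq)
      qed
    qed
    then show "c = 0\<^sub>v (length ?gs)"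
      using independent_modD[OF ind] c(1) by simp
  qed
  ultimately show ?thesis
    using place.independent_mod_place_length_le by fastforce
qed

lemma RR_space_span_add_place:
  assumes P: "is_place \<iota> P" and S: "finite S" "RR_space A \<subseteq> K.span S"
  obtains T where "finite T" "RR_space (A + place_divisor P) \<subseteq> K.span T"
    "card T \<le> card S + place_degree \<iota> P"
proof -
  obtain fs where fs: "set fs \<subseteq> RR_space (A + place_divisor P)" "independent_mod (RR_space A) fs"
    and gen: "\<And>f. f \<in> RR_space (A + place_divisor P) \<Longrightarrow>
      \<exists>c\<in>carrier_vec (length fs). f - lin_comb \<iota> c fs \<in> RR_space A"
    using exists_basis_mod[OF subspace_RR_space, of "RR_space (A + place_divisor P)" A]
      independent_mod_RR_space_length_le[OF P] by metis
  show thesis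
  proof (rule that[of "S \<union> set fs"])
    show "RR_space (A + place_divisor P) \<subseteq> K.span (S \<union> set fs)"
    proof
      fix f assume "f \<in> RR_space (A + place_divisor P)"
      then obtain c where "f - lin_comb \<iota> c fs \<in> K.span S"
        using gen S(2) by blast
      then have "f - lin_comb \<iota> c fs \<in> K.span (S \<union> set fs)"
        using K.span_mono[of S "S \<union> set fs"] by blast
      moreover have "lin_comb \<iota> c fs \<in> K.span (S \<union> set fs)"
        by (intro lin_comb_in_subspace) (auto intro: K.span_base)
      ultimately show "f \<in> K.span (S \<union> set fs)"
        using K.span_add by fastforce
    qed
    show "card (S \<union> set fs) \<le> card S + place_degree \<iota> P"
      using card_Un_le[of S "set fs"] card_length[of fs]
        independent_mod_RR_space_length_le[OF P fs] by linarith
  qed (use S in simp)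
qed

lemma RR_space_span_add_place_multiple:
  assumes P: "is_place \<iota> P" and S: "finite S" "RR_space A \<subseteq> K.span S"
  shows "\<exists>T. finite T \<and> RR_space (A + Poly_Mapping.single P (int m)) \<subseteq> K.span T \<and>
    card T \<le> card S + m * place_degree \<iota> P"
proof (induction m)
  case 0
  then show ?case using S by auto
next
  case (Suc m)
  then obtain T where T: "finite T" "RR_space (A + Poly_Mapping.single P (int m)) \<subseteq> K.span T"
    "card T \<le> card S + m * place_degree \<iota> P"
    by blast
  obtain T' where "finite T'" "RR_space (A + Poly_Mapping.single P (int m) + place_divisor P) \<subseteq> K.span T'"
    "card T' \<le> card T + place_degree \<iota> P"
    using RR_space_span_add_place[OF P T(1,2)] by blast
  moreover from this(3) have "card T' \<le> card S + Suc m * place_degree \<iota> P"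
    using T(3) by simp
  moreover have "A + Poly_Mapping.single P (int (Suc m)) =
      A + Poly_Mapping.single P (int m) + place_divisor P"
    by (rule poly_mapping_eqI) (simp add: lookup_add lookup_single when_def)
  ultimately show ?case
    by (simp only:) blast
qed

text \<open>
  Adding the places of \<open>E\<close> one at a time gives \<open>dim \<L>(A + E) \<le> dim \<L>(A) + deg E\<close>. The bound is stated
  through spanning sets, so that finite-dimensionality is part of the conclusion.
\<close>

lemma RR_space_span_add_effective:
  assumes E: "is_divisor E" "effective E" and S: "finite S" "RR_space A \<subseteq> K.span S"
  obtains T where "finite T" "RR_space (A + E) \<subseteq> K.span T"
    "int (card T) \<le> int (card S) + divisor_degree E"
proof -
  have "\<exists>T. finite T \<and> RR_space (A + (\<Sum>P\<in>X. Poly_Mapping.single P (Poly_Mapping.lookup E P))) \<subseteq> K.span T \<and>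
      int (card T) \<le> int (card S) + (\<Sum>P\<in>X. Poly_Mapping.lookup E P * int (place_degree \<iota> P))"
    if "finite X" "X \<subseteq> Poly_Mapping.keys E" for X
    using that
  proof (induction X rule: finite_induct)
    case empty
    then show ?case using S by auto
  next
    case (insert P X)
    let ?X = "\<Sum>P\<in>X. Poly_Mapping.single P (Poly_Mapping.lookup E P)"
    obtain T where T: "finite T" "RR_space (A + ?X) \<subseteq> K.span T"
      "int (card T) \<le> int (card S) + (\<Sum>P\<in>X. Poly_Mapping.lookup E P * int (place_degree \<iota> P))"
      using insert by auto
    define m where "m = nat (Poly_Mapping.lookup E P)"
    have m: "Poly_Mapping.lookup E P = int m"
      using E(2) by (simp add: m_def effective_def)
    have P: "is_place \<iota> P"
      using insert.prems E(1) by (auto simp: is_divisor_def)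
    obtain T' where "finite T'" "RR_space (A + ?X + Poly_Mapping.single P (int m)) \<subseteq> K.span T'"
      "card T' \<le> card T + m * place_degree \<iota> P"
      using RR_space_span_add_place_multiple[OF P T(1,2)] by blast
    moreover from this(3) have "int (card T') \<le> int (card T) + int m * int (place_degree \<iota> P)"
      by (metis of_nat_add of_nat_le_iff of_nat_mult)
    ultimately show ?case
      using T(3) insert.hyps m by (intro exI[of _ T']) (simp add: ac_simps)
  qed
  from this[OF finite_keys order_refl] obtain T where T: "finite T"
    "RR_space (A + (\<Sum>P\<in>Poly_Mapping.keys E. Poly_Mapping.single P (Poly_Mapping.lookup E P))) \<subseteq> K.span T"
    "int (card T) \<le> int (card S) + divisor_degree E"
    by (auto simp: divisor_degree_def)
  moreover have "(\<Sum>P\<in>Poly_Mapping.keys E. Poly_Mapping.single P (Poly_Mapping.lookup E P)) = E"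
    by (rule poly_mapping_eqI) (auto simp: lookup_sum lookup_single when_def in_keys_iff)
  ultimately show thesis
    using that by simp
qed

lemma divisor_degree_minus_place:
  assumes "Q \<notin> Poly_Mapping.keys A"
  shows "divisor_degree (A - place_divisor Q) = divisor_degree A - int (place_degree \<iota> Q)"
proof -
  have lookup_Q: "Poly_Mapping.lookup A Q = 0"
    using assms by (simp add: in_keys_iff)
  have lookup: "Poly_Mapping.lookup (A - place_divisor Q) P =
      (if P = Q then - 1 else Poly_Mapping.lookup A P)" for P
    using lookup_Q by (simp add: lookup_minus lookup_single when_def)
  have "Poly_Mapping.keys (A - place_divisor Q) = insert Q (Poly_Mapping.keys A)"
    by (auto simp: in_keys_iff lookup split: if_splits)
  moreover have "(\<Sum>P\<in>Poly_Mapping.keys A. Poly_Mapping.lookup (A - place_divisor Q) P * int (place_degree \<iota> P))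
      = divisor_degree A"
    unfolding divisor_degree_def using assms by (intro sum.cong) (auto simp: lookup)
  ultimately show ?thesis
    using assms by (simp add: divisor_degree_def lookup)
qed

end

section \<open>Zeros of matrices and of functions\<close>

lemma num_zeros_le_column_bound:
  assumes "\<And>j. j < dim_col M \<Longrightarrow> card {i. i < dim_row M \<and> M $$ (i, j) = 0} \<le> b"
  shows "num_zeros M \<le> dim_col M * b"
proof -
  let ?Z = "\<lambda>j. {i. i < dim_row M \<and> M $$ (i, j) = 0}"
  have "num_zeros M = card ((\<lambda>(j, i). (i, j)) ` Sigma {..<dim_col M} ?Z)"
    unfolding num_zeros_def by (intro arg_cong[of _ _ card]) auto
  also have "\<dots> \<le> card (Sigma {..<dim_col M} ?Z)"
    by (intro card_image_le finite_SigmaI) auto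
  also have "\<dots> = (\<Sum>j<dim_col M. card (?Z j))"
    by (intro card_SigmaI) auto
  also have "\<dots> \<le> (\<Sum>j<dim_col M. b)"
    using assms by (intro sum_mono) auto
  finally show ?thesis by simp
qed

lemma num_zeros_less_size:
  assumes "M \<in> carrier_mat m n" "M \<noteq> 0\<^sub>m m n"
  shows "num_zeros M < m * n"
proof -
  have "\<exists>i<m. \<exists>j<n. M $$ (i, j) \<noteq> 0"
  proof (rule ccontr)
    assume "\<not> ?thesis"
    then have "M = 0\<^sub>m m n"
      using assms(1) by (intro eq_matI) auto
    then show False
      using assms(2) by simp
  qed
  then obtain i j where ij: "i < m" "j < n" "M $$ (i, j) \<noteq> 0"
    by blast
  have "{(i, j). i < dim_row M \<and> j < dim_col M \<and> M $$ (i, j) = 0} \<subset> {..<m} \<times> {..<n}"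
    using assms(1) ij by auto
  then have "num_zeros M < card ({..<m} \<times> {..<n})"
    unfolding num_zeros_def by (intro psubset_card_mono) auto
  then show ?thesis
    by (simp add: card_cartesian_product)
qed

context function_field
begin

lemma Ev_P_matrix_carrier: "Ev_P_matrix Ps bs \<in> carrier_mat (length Ps) (length bs)"
  by (simp add: Ev_P_matrix_def)

end

context chudnovsky
begin

lemma place_in_Ps:
  assumes "i < length Ps"
  shows "function_field_place \<iota> (Ps ! i)" "place_degree \<iota> (Ps ! i) = 1"
    "RR_space (D + D) \<subseteq> place_ring (Ps ! i)"
proof -
  have P: "Ps ! i \<in> set Ps"
    using assms by simp
  then show "function_field_place \<iota> (Ps ! i)" "place_degree \<iota> (Ps ! i) = 1"
    using places_Ps function_field_place by auto
  have "Ps ! i \<notin> Poly_Mapping.keys D"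
    using support_D P by auto
  then have "Ps ! i \<notin> Poly_Mapping.keys (D + D)"
    by (simp add: in_keys_iff lookup_add)
  then show "RR_space (D + D) \<subseteq> place_ring (Ps ! i)"
    using RR_space_subset_place_ring places_Ps[OF P] by blast
qed

lemma RR_space_D_subset: "RR_space D \<subseteq> RR_space (D + D)"
  using effective_D by (intro RR_space_mono) (simp add: effective_def lookup_add)

lemma Ev_P_lin_comb:
  assumes "set bs \<subseteq> RR_space (D + D)"  "i < length Ps"
  shows "Ev_P Ps (lin_comb \<iota> c bs) $ i = (\<Sum>j<length bs. c $ j * Ev_P Ps (bs ! j) $ i)"
proof -
  interpret place: function_field_place \<iota> "Ps ! i"
    using assms(2) by (rule place_in_Ps)
  show ?thesis
    using place.eval_at_lin_comb[of bs c] place_in_Ps[OF assms(2)] assms by (simp add: Ev_P_def)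
qed

lemma Ev_P_eq_0_imp_eq_0:
  assumes "f \<in> RR_space (D + D)" "\<And>i. i < length Ps \<Longrightarrow> Ev_P Ps f $ i = 0"
  shows "f = 0"
proof -
  have "Ev_P Ps (lin_comb \<iota> vNil []) $ i = 0" if "i < length Ps" for i
    using Ev_P_lin_comb[of "[]"] that by simp
  then have "Ev_P Ps f = Ev_P Ps 0"
    using assms(2) by (intro eq_vecI) (auto simp: Ev_P_def)
  then show ?thesis
    using Ev_P_inj assms(1) K.subspace_0[OF subspace_RR_space] by (auto dest: inj_onD)
qed

lemma divisor_degree_D: "divisor_degree D = int n + genus - 1"
  using divisor_degree_minus_place[of Q D] support_D D_minus_Q_degree degree_Q by auto

text \<open>
  The products \<open>f g\<close> with \<open>g\<close> in the span of \<open>bs\<close> form a space of dimension \<open>length bs\<close> inside \<open>\<L>(2D)\<close>, and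
  all of them vanish at the zeros of \<open>f\<close>. If there were fewer than \<open>length bs\<close> points outside these
  zeros, a nonzero product would vanish at all points, against the injectivity of \<open>Ev\<^sub>P\<close>. With a basis
  of \<open>\<L>(D)\<close> this gives the bound \<open>N - n\<close> that is usually obtained from the degree of the zero divisor.
\<close>

lemma card_zeros_le:
  assumes f: "f \<in> RR_space D" "f \<noteq> 0"
    and bs: "set bs \<subseteq> RR_space D" "independent_mod {0} bs"
  shows "card {i. i < length Ps \<and> Ev_P Ps f $ i = 0} + length bs \<le> length Ps"
proof (rule ccontr)
  let ?Z = "{i. i < length Ps \<and> Ev_P Ps f $ i = 0}"
  assume "\<not> ?thesis"
  moreover have "card ({..<length Ps} - ?Z) = length Ps - card ?Z"
    by (subst card_Diff_subset) auto
  moreover have "card ?Z \<le> card {..<length Ps}"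
    by (intro card_mono) auto
  ultimately have "card ({..<length Ps} - ?Z) < length bs"
    by simp
  then obtain v where v: "v \<in> carrier_vec (length bs)" "v \<noteq> 0\<^sub>v (length bs)"
    and ker: "\<And>i. i \<in> {..<length Ps} - ?Z \<Longrightarrow> (\<Sum>j<length bs. v $ j * Ev_P Ps (f * bs ! j) $ i) = 0"
    using underdetermined_finite_system_nontrivial[of "{..<length Ps} - ?Z" "length bs"
        "\<lambda>i j. Ev_P Ps (f * bs ! j) $ i"] by blast
  let ?g = "lin_comb \<iota> v bs"
  have g: "?g \<in> RR_space D"
    by (rule lin_comb_in_subspace[OF subspace_RR_space bs(1)])
  have "f * ?g = 0"
  proof (rule Ev_P_eq_0_imp_eq_0)
    show "f * ?g \<in> RR_space (D + D)"
      by (rule RR_space_mult[OF f(1) g])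
    fix i assume i: "i < length Ps"
    show "Ev_P Ps (f * ?g) $ i = 0"
    proof (cases "i \<in> ?Z")
      case True
      interpret place: function_field_place \<iota> "Ps ! i"
        using i by (rule place_in_Ps)
      have "f \<in> place_ring (Ps ! i)" "?g \<in> place_ring (Ps ! i)"
        using place_in_Ps(3)[OF i] RR_space_D_subset f(1) g by auto
      then show ?thesis
        using True i place.eval_at_mult_eq_0[of f ?g] place_in_Ps(2)[OF i] by (simp add: Ev_P_def)
    next
      case False
      have "set (map ((*) f) bs) \<subseteq> RR_space (D + D)"
        using RR_space_mult[OF f(1)] bs(1) by auto
      then have "Ev_P Ps (f * ?g) $ i = (\<Sum>j<length bs. v $ j * Ev_P Ps (f * bs ! j) $ i)"
        using Ev_P_lin_comb[of "map ((*) f) bs" i v] i by (simp add: lin_comb_map_mult)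
      then show ?thesis
        using ker[of i] False i by simp
    qed
  qed
  then have "lin_comb \<iota> v bs \<in> {0}"
    using f(2) by simp
  then show False
    using independent_modD[OF bs(2) v(1)] v(2) by blast
qed

end

section \<open>Kernel-type algorithms\<close>

context kernel_type_chudnovsky
begin

lemma length_basis_2D: "length (BD @ BDc) = length Ps"
proof -
  have "RR_dim (D + D) = card (set (BD @ BDc))"
    unfolding RR_dim_def using basis_2D K.dim_span_eq_card_independent
    by (metis ordered_basis_def)
  also have "\<dots> = length (BD @ BDc)"
    using basis_2D by (intro distinct_card) (simp add: ordered_basis_def)
  finally show ?thesis
    by (simp add: length_Ps)
qed

lemma set_BD_subset: "set BD \<subseteq> RR_space D" and set_basis_2D_subset: "set (BD @ BDc) \<subseteq> RR_space (D + D)"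
  using basis_D basis_2D K.span_superset unfolding ordered_basis_def by blast+

lemma independent_basis_2D: "independent_mod {0} (BD @ BDc)" and independent_BD: "independent_mod {0} BD"
  using basis_2D basis_D by (auto simp: ordered_basis_def intro!: independent_mod_zeroI)

text \<open>
  \<open>N = dim \<L>(2D) \<le> dim \<L>(D) + deg D = n + (n + g - 1)\<close>, where the degree of \<open>D\<close> comes from the
  hypothesis that \<open>D - Q\<close> has degree \<open>g - 1\<close>.
\<close>

lemma length_Ps_le: "int (length Ps) \<le> 2 * int n + genus - 1"
proof -
  have "RR_space D \<subseteq> K.span (set BD)" "card (set BD) = n"
    using basis_D length_BD by (auto simp: ordered_basis_def distinct_card)
  then obtain T where T: "finite T" "RR_space (D + D) \<subseteq> K.span T" "int (card T) \<le> int n + divisor_degree D"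
    using RR_space_span_add_effective[OF divisor_D effective_D, of "set BD" D] by auto
  have "card (set (BD @ BDc)) \<le> card T"
    using K.independent_span_bound[of T "set (BD @ BDc)"] T basis_2D set_basis_2D_subset
    by (metis order_trans ordered_basis_def)
  moreover have "card (set (BD @ BDc)) = length Ps"
    using basis_2D length_basis_2D distinct_card unfolding ordered_basis_def by metis
  ultimately show ?thesis
    using T(3) divisor_degree_D by linarith
qed

lemma num_zeros_T_D_le: "num_zeros (T_D Ps BD) \<le> n * (length Ps - n)"
proof -
  have dims: "dim_row (T_D Ps BD) = length Ps" "dim_col (T_D Ps BD) = n"
    by (simp_all add: T_D_def Ev_P_matrix_def length_BD)
  have "num_zeros (T_D Ps BD) \<le> dim_col (T_D Ps BD) * (length Ps - n)"
  proof (rule num_zeros_le_column_bound)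
    fix j assume "j < dim_col (T_D Ps BD)"
    then have j: "j < length BD"
      by (simp add: dims length_BD)
    have "0 \<notin> set BD"
      using basis_D K.dependent_zero by (auto simp: ordered_basis_def)
    then have "BD ! j \<noteq> 0"
      using j nth_mem by metis
    moreover have "BD ! j \<in> RR_space D"
      using set_BD_subset j nth_mem by blast
    ultimately have "card {i. i < length Ps \<and> Ev_P Ps (BD ! j) $ i = 0} + n \<le> length Ps"
      using card_zeros_le[OF _ _ set_BD_subset independent_BD] length_BD by simp
    moreover have "{i. i < dim_row (T_D Ps BD) \<and> T_D Ps BD $$ (i, j) = 0} =
        {i. i < length Ps \<and> Ev_P Ps (BD ! j) $ i = 0}"
      using j by (auto simp: T_D_def Ev_P_matrix_def)
    ultimately show "card {i. i < dim_row (T_D Ps BD) \<and> T_D Ps BD $$ (i, j) = 0} \<le> length Ps - n"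
      by simp
  qed
  then show ?thesis
    by (simp add: dims)
qed

lemma T_2D_carrier: "T_2D Ps BD BDc \<in> carrier_mat (length Ps) (length Ps)"
  using Ev_P_matrix_carrier[of Ps "BD @ BDc"] by (simp only: T_2D_def length_basis_2D)

lemma T_2D_inverse:
  obtains B where "mat_inverse (T_2D Ps BD BDc) = Some B" "B \<in> carrier_mat (length Ps) (length Ps)"
    "B * T_2D Ps BD BDc = 1\<^sub>m (length Ps)"
proof -
  let ?T = "T_2D Ps BD BDc" and ?N = "length Ps" and ?bs = "BD @ BDc"
  have "det ?T \<noteq> 0"
  proof
    assume "det ?T = 0"
    then obtain v where v: "v \<in> carrier_vec ?N" "v \<noteq> 0\<^sub>v ?N" "?T *\<^sub>v v = 0\<^sub>v ?N"
      using det_0_iff_vec_prod_zero_field[OF T_2D_carrier] by blast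
    have "lin_comb \<iota> v ?bs = 0"
    proof (rule Ev_P_eq_0_imp_eq_0)
      show "lin_comb \<iota> v ?bs \<in> RR_space (D + D)"
        by (rule lin_comb_in_subspace[OF subspace_RR_space set_basis_2D_subset])
      fix i assume i: "i < ?N"
      have "Ev_P Ps (lin_comb \<iota> v ?bs) $ i = (\<Sum>j<?N. v $ j * Ev_P Ps (?bs ! j) $ i)"
        using Ev_P_lin_comb[OF set_basis_2D_subset i] by (simp only: length_basis_2D)
      also have "\<dots> = (?T *\<^sub>v v) $ i"
        using i v(1) length_basis_2D
        by (simp add: T_2D_def Ev_P_matrix_def scalar_prod_def lessThan_atLeast0 mult.commute)
      finally show "Ev_P Ps (lin_comb \<iota> v ?bs) $ i = 0"
        using v(3) i by simp
    qed
    then show False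
      using independent_modD[OF independent_basis_2D] v(1,2) by (simp only: length_basis_2D) simp
  qed
  then have "?T \<in> Units (ring_mat TYPE('k) ?N ())"
    by (rule det_non_zero_imp_unit[OF T_2D_carrier])
  then obtain B where "mat_inverse ?T = Some B"
    using mat_inverse(1)[OF T_2D_carrier] by fastforce
  then show thesis
    using that mat_inverse(2)[OF T_2D_carrier] by blast
qed

text \<open>
  A combination of \<open>BD\<close> that vanishes at \<open>Q\<close> lies in the kernel of \<open>E\<^sub>Q\<close> and is thus a combination of \<open>BDc\<close>,
  while \<open>BD\<close> and \<open>BDc\<close> together are independent.
\<close>

lemma independent_mod_Q_BD: "independent_mod Q BD"
  unfolding independent_mod_def
proof (intro ballI impI)
  fix c assume c: "c \<in> carrier_vec (length BD)" "lin_comb \<iota> c BD \<in> Q"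
  interpret place: function_field_place \<iota> Q
    using place_Q by (rule function_field_place)
  have "lin_comb \<iota> c BD \<in> RR_space (D + D)"
    using lin_comb_in_subspace[OF subspace_RR_space set_BD_subset] RR_space_D_subset by blast
  moreover have "residue_class Q (lin_comb \<iota> c BD) = residue_class Q 0"
    using c(2) by (simp add: place.residue_class_eq_iff)
  ultimately have "lin_comb \<iota> c BD \<in> K.span (set BDc)"
    using basis_kernel by (simp add: ordered_basis_def)
  then obtain d where d: "d \<in> carrier_vec (length BDc)" "lin_comb \<iota> c BD = lin_comb \<iota> d BDc"
    by (auto simp: in_span_list_iff)
  have "lin_comb \<iota> (c @\<^sub>v ((- 1) \<cdot>\<^sub>v d)) (BD @ BDc) = 0"
    using c d by (simp add: lin_comb_append lin_comb_smult hom_uminus)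
  then have zero: "c @\<^sub>v ((- 1) \<cdot>\<^sub>v d) = 0\<^sub>v (length (BD @ BDc))"
    using c d by (intro independent_modD[OF independent_basis_2D]) auto
  have "c $ i = 0" if "i < length BD" for i
    using arg_cong[OF zero, of "\<lambda>v. v $ i"] that c(1) d(1) by simp
  then show "c = 0\<^sub>v (length BD)"
    using c(1) by (intro eq_vecI) auto
qed

text \<open>
  The first column of \<open>C\<close> is the first unit vector, since the class of the first element of \<open>BD\<close> belongs to
  the basis of the residue class field.
\<close>

lemma C_matrix_nonzero: "C_matrix Q BD BDc \<noteq> 0\<^sub>m n (length Ps)"
proof -
  interpret place: function_field_place \<iota> Q
    using place_Q by (rule function_field_place)
  have n0: "0 < length BD" using n_pos length_BD by simp
  have coords: "is_residue_coords \<iota> Q BD (residue_class Q (BD ! 0)) (unit_vec n 0)"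
  proof -
    have "lin_comb \<iota> (unit_vec n 0) BD = (\<Sum>j<length BD. if j = 0 then BD ! j else 0)"
      unfolding lin_comb_def using length_BD by (intro sum.cong) auto
    also have "\<dots> = BD ! 0"
      using n0 by simp
    finally show ?thesis
      by (simp add: is_residue_coords_def length_BD)
  qed
  have "residue_coords \<iota> Q BD (residue_class Q (BD ! 0)) = unit_vec n 0"
    unfolding residue_coords_def
  proof (rule the_equality)
    show "is_residue_coords \<iota> Q BD (residue_class Q (BD ! 0)) (unit_vec n 0)"
      by (rule coords)
  next
    fix c assume c: "is_residue_coords \<iota> Q BD (residue_class Q (BD ! 0)) c"
    have "lin_comb \<iota> (c - unit_vec n 0) BD \<in> Q"
      using c coords length_BD
      by (simp add: is_residue_coords_def lin_comb_diff place.residue_class_eq_iff[symmetric])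
    then have "c - unit_vec n 0 = 0\<^sub>v (length BD)"
      using c coords by (intro independent_modD[OF independent_mod_Q_BD]) (auto simp: is_residue_coords_def)
    then have "\<forall>i<n. (c - unit_vec n 0) $ i = 0"
      using length_BD by simp
    then show "c = unit_vec n 0"
      using c length_BD by (auto simp: is_residue_coords_def vec_eq_iff)
  qed
  then have "C_matrix Q BD BDc $$ (0, 0) = 1"
    using n0 length_BD by (simp add: C_matrix_def nth_append)
  moreover have "n > 0" "length Ps > 0"
    using n_pos length_basis_2D length_BD by auto
  ultimately show ?thesis
    by auto
qed

text \<open>
  If \<open>C T\<^sup>-\<^sup>1\<close> were zero, so would be \<open>C = (C T\<^sup>-\<^sup>1) T\<close>. Hence at least one of its \<open>n N\<close> entries is nonzero.
\<close>

lemma num_zeros_reconstruction_less: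
  "num_zeros (C_matrix Q BD BDc * the (mat_inverse (T_2D Ps BD BDc))) < n * length Ps"
proof -
  let ?C = "C_matrix Q BD BDc" and ?T = "T_2D Ps BD BDc" and ?N = "length Ps"
  obtain B where B: "mat_inverse ?T = Some B" "B \<in> carrier_mat ?N ?N" "B * ?T = 1\<^sub>m ?N"
    by (rule T_2D_inverse)
  have C: "?C \<in> carrier_mat n ?N"
    using length_BD length_basis_2D by (simp add: C_matrix_def)
  have "?C * B \<noteq> 0\<^sub>m n ?N"
  proof
    assume "?C * B = 0\<^sub>m n ?N"
    then have "?C * B * ?T = 0\<^sub>m n ?N"
      using T_2D_carrier by simp
    moreover have "?C * B * ?T = ?C"
      using assoc_mult_mat[OF C B(2) T_2D_carrier] B(3) C by simp
    ultimately show False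
      using C_matrix_nonzero by simp
  qed
  then show ?thesis
    using num_zeros_less_size[of "?C * B" n ?N] C B(1,2) by simp
qed

theorem scalar_complexity_bounds:
  shows "mu_s0_A n Ps BD \<ge> 2 * (int n)\<^sup>2" and "mu_s0 n Q Ps BD BDc > 2 * (int n)\<^sup>2"
proof -
  have n_le: "n \<le> length Ps"
    using length_basis_2D length_BD by simp
  let ?M = "2 * int n + genus - 1"
  have "int (num_zeros (T_D Ps BD)) \<le> int (n * (length Ps - n))"
    using num_zeros_T_D_le by (simp only: of_nat_le_iff)
  also have "\<dots> = int n * (int (length Ps) - int n)"
    using n_le by (simp add: of_nat_diff)
  also have "\<dots> \<le> int n * (?M - int n)"
    using length_Ps_le by (intro mult_left_mono) auto
  finally show A: "mu_s0_A n Ps BD \<ge> 2 * (int n)\<^sup>2"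
    by (simp add: mu_s0_A_def power2_eq_square algebra_simps)
  have "int (num_zeros (C_matrix Q BD BDc * the (mat_inverse (T_2D Ps BD BDc)))) < int (n * length Ps)"
    using num_zeros_reconstruction_less by (simp only: of_nat_less_iff)
  also have "\<dots> = int n * int (length Ps)"
    by simp
  also have "\<dots> \<le> int n * ?M"
    using length_Ps_le by (intro mult_left_mono) auto
  finally show "mu_s0 n Q Ps BD BDc > 2 * (int n)\<^sup>2"
    using A by (simp add: mu_s0_def mu_s0_A_def algebra_simps)
qed

end

theorem theorem3p1:
  fixes \<iota> :: "'k::{field,finite} \<Rightarrow> 'f::field"
    and n :: nat and D :: "'f divisor" and Q :: "'f set" and Ps :: "'f set list"
    and BD BDc :: "'f list"
  assumes "kernel_type_chudnovsky \<iota> n D Q Ps BD BDc"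
  shows "function_field.mu_s0_A \<iota> n Ps BD \<ge> 2 * (int n)^2 \<and>
         function_field.mu_s0 \<iota> n Q Ps BD BDc > 2 * (int n)^2"
proof -
  interpret kernel_type_chudnovsky \<iota> n D Q Ps BD BDc
    by (rule assms)
  show ?thesis
    using scalar_complexity_bounds by blast
qed

end
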